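(* Let $\mathcal G=(X,E)$ be a finite connected graph without loop edges or multiple edges and let $d\ge 1$. (a) For any $U(d)$-connection modulus $A$ on $\mathcal G$ and any collection $\tilde{\mathcal L}$ of geodesic loops, setting $\tau_A(\tilde{\mathcal L})=\prod_{l\in\tilde{\mathcal L}}\mathrm{Tr}(h_A(l))$ and $\tau_A(\emptyset)=d$, we have the intertwining property $$\mathfrak A^{(\mathcal C)}\tau_A(\tilde{\mathcal L})=-\big[(d-1)S+V^+-V^-+B^{SM+}-B^{SM-}\big]\tau_A(\tilde{\mathcal L}),$$ where on the left-hand side the Casimir operator $\mathfrak A^{(\mathcal C)}$ acts on $\tau_A(\tilde{\mathcal L})$ with $\tilde{\mathcal L}$ fixed, and on the right-hand side the split-and-merge operators act on $\tau_A(\tilde{\mathcal L})$ with $A$ fixed. In particular, for any collection $\mathcal L_{flw}$ of geodesic loops whose induced network is a flow, $$\mathfrak A^{(\mathcal C)}\tau_A(\mathcal L_{flw})=-\big[(d-1)S+V^++B^{SM+}\big]\tau_A(\mathcal L_{flw}).$$ (b) For any gauge group element $\{g\}\in U(d)^X$ and any collection $\mathcal L$ of loops, setting $T_{\{g\}}(\mathcal L)=\prod_{l\in\mathcal L}\mathrm{Tr}(q_{\{g\}}(l))$, we have $$\mathfrak A^{(\mathcal X)}T_{\{g\}}(\mathcal L)=-\big[(d-1)S+V+B^{SM}\big]T_{\{g\}}(\mathcal L),$$ where on the left $\mathfrak A^{(\mathcal X)}$ acts with $\mathcal L$ fixed, and on the right the operators act with $\{g\}$ fixed.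
   Context: Loops. $\mathcal G=(X,E)$ is a finite connected graph without loop edges or multiple edges; $E^o$ is the set of oriented edges. A based loop is a path $\xi=(\xi_0,\xi_1,\dots,\xi_p=\xi_0)$, $p=p(\xi)$, with consecutive vertices adjacent. A (discrete) loop is an equivalence class of based loops under cyclic shift; indices are taken modulo $p$. Trivial one-point loops are not considered. A geodesic loop is a loop without backtracking (cyclically). To every loop $l$ is associated a canonical geodesic loop $l^R$, obtained by removing all tree-contour-like based loops imbedded into it (based loops whose lifts to the universal cover of the graph are still based loops); this can be done by iteratively removing pairs of opposite consecutive edges. A collection is a finite multiset (each element has a multiplicity); $\emptyset$ is the empty collection. Occupation numbers. $N_{x,y}(l)$ is the number of crossings of the oriented edge $(x,y)$ by $l$, and $N_x(l)=\sum_yN_{x,y}(l)$. For a collection, $N_{x,y}(\mathcal L)=\sum_{l\in\mathcal L}N_{x,y}(l)$ and $N_x(\mathcal L)=\sum_{l\in\mathcal L}N_x(l)$. The network induced by $\mathcal L$ is $(N_{x,y}(\mathcal L))$; it is a flow if $N_{x,y}N_{y,x}=0$ for every edge $\{x,y\}$. Set $$S=\sum_xN_x=\sum_{x,y}N_{x,y},\quad V=\sum_xN_x^2,\quad V^+=\sum_{\{x,y\}}(N_{x,y}^2+N_{y,x}^2),\quad V^-=2\sum_{\{x,y\}}N_{x,y}N_{y,x},$$ acting by multiplication on functions of collections. Split-and-merge operators. A transition kernel $K$ acts on functions of collections by $KF(\mathcal L)=\sum_{\mathcal L'}K(\mathcal L,\mathcal L')F(\mathcal L')$. Terms with zero rate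 below are zero. $Q_{(x)}$: two indices are chosen uniformly and independently among the $x$-visit indices of all loops. If they belong to different loops, these loops are concatenated at these indices. If they are distinct but on the same loop, the loop is cut at these indices to form two loops by connecting the two ends of each part. There is no change when the two choices coincide. $B^{SM}=\sum_{x}N_x^2[Q_{(x)}-I]$. $K^+_{(x,y)}$, $(x,y)\in E^o$: two indices are chosen uniformly and independently among those at which an $(x,y)$-crossing starts in some loop. If they belong to different loops, these are merged by concatenation at these indices. If they are distinct but on the same loop, the loop is disconnected into two paths from $x$ to $x$, both starting with the edge $(x,y)$, to form two loops. Nothing happens if the two choices coincide. $B^{SM+}=\sum_{(x,y)\in E^o}N_{x,y}^2[K^+_{(x,y)}-I]$. $K^{-,R}_{x,y}$: if both $(x,y)$ and $(y,x)$ are traversed by the collection, sample uniformly one element among all loop crossings of $(x,y)$ and another among all loop crossings of $(y,x)$. If these crossings occur on the same loop, that loop decomposes into the crossing of $(x,y)$, a bridge from $y$ to $y$, the crossing of $(y,x)$, and a bridge from $x$ to $x$; the loop is replaced by the two loops induced by these two bridges (negative split). If they occur on different loops, these decompose respectively into the crossing of $(x,y)$ followed by a bridge from $y$ to $x$, and the crossing of $(y,x)$ followed by a bridge from $x$ to $y$; the two bridges are merged into one loop, which replaces both loops. As merging may produce a loop with backtracking, the reduction map $l\mapsto l^R$ is applied to each merging output. This may produce an empty collection. $B^{SM-}=\sum_{(x,y)\in E^o}N_{x,y}N_{y,x}[K^{-,R}_{x,y}-I]$ (sum over ordered pairs). Connections. A $U(d)$-connection is a map $m:E^o\to U(d)$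 ($U(d)$ the group of unitary $d\times d$ matrices) with $m(x,y)=m(y,x)^{-1}$; $\mathcal C$ is the set of connections. The gauge group is $\mathcal X=U(d)^X$. Connections $m,m'$ are equivalent if $m'(x,y)=h(y)^{-1}m(x,y)h(x)$ for some $h\in\mathcal X$; connection moduli are the equivalence classes. For a modulus $A$ with representative $m$ and a loop $l$ with based representative $(\xi_0,\dots,\xi_p=\xi_0)$, the holonomy $h_A(l)$ is the conjugacy class of $m(\xi_{p-1},\xi_p)\cdots m(\xi_0,\xi_1)$; it depends only on $A$ and $l$, and in fact only on $A$ and $l^R$. The formula for $\tau_A$ is used for collections of arbitrary loops. For $\{g\}\in\mathcal X$ and a loop $l$ with representative $(x_0,\dots,x_{n-1},x_0)$, $q_{\{g\}}(l)$ is the conjugacy class of $g(x_0)g(x_1)\cdots g(x_{n-1})$. Casimir operators. For an antihermitian matrix $W$ and smooth $f$ on $U(d)$, $\mathfrak L_Wf(g)=\lim_{\epsilon\to0}\epsilon^{-1}(f(e^{\epsilon W}g)-f(g))$. The Casimir operator is $\mathfrak A=\sum_l\mathfrak L_{W_l}^2$ for any basis $(W_l)$ of the real vector space of antihermitian matrices that is orthonormal for the form given by $\mathrm{Tr}(WW^* )$. $\mathfrak A^{(\mathcal X)}=\sum_{x\in X}\mathfrak A^{(x)}$, where $\mathfrak A^{(x)}$ is $\mathfrak A$ acting on the $x$-coordinate of $U(d)^X$. $\mathfrak A^{(\mathcal C)}=\sum_{\{x,y\}\in E}\mathfrak A^{(\{x,y\})}$, where, after choosing an orientation of each edge to identify $\mathcal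 C$ with $U(d)^E$, $\mathfrak A^{(\{x,y\})}$ is $\mathfrak A$ acting on the coordinate of the edge $\{x,y\}$. This operator does not depend on the choice of orientations and acts on functions defined on the space of connection moduli, to which it is restricted here.
   Formalization: If a merging output of K^{-,R} reduces to a point while other loops remain, the trivial loop is kept in the collection with factor Tr(I)=d rather than deleted; with deletion (a) fails for d≥2, e.g. for {l, l^{-1}, l'} with l' edge-disjoint from l. *)

theory Defs
  imports
    "HOL-Analysis.Analysis"
    "HOL-Probability.Probability_Mass_Function"
    "Graph_Theory.Graph_Theory"
begin

section \<open>Matrices, the unitary group and its Casimir operator\<close>

definition cadj :: "complex^'d^'d \<Rightarrow> complex^'d^'d" where
  "cadj M = (\<chi> i j. cnj (M $ j $ i))"

definition unitary_group :: "(complex^'d^'d) set" where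
  "unitary_group = {g. cadj g ** g = mat 1 \<and> g ** cadj g = mat 1}"

definition antihermitian :: "complex^'d^'d \<Rightarrow> bool" where
  "antihermitian W \<longleftrightarrow> cadj W = - W"

text \<open>The matrix exponential is spelled out, since multiplication on the type
  \<open>complex^'d^'d\<close> is componentwise and the library function \<open>exp\<close> is not available there.\<close>

definition mpow :: "complex^'d^'d \<Rightarrow> nat \<Rightarrow> complex^'d^'d" where
  "mpow M n = (((**) M) ^^ n) (mat 1)"

definition mexp :: "complex^'d^'d \<Rightarrow> complex^'d^'d" where
  "mexp M = (\<Sum>n. mpow M n /\<^sub>R fact n)"

text \<open>Orthonormality refers to the polarisation \<open>Tr (W W'\<^sup>*)\<close> of \<open>Tr (W W\<^sup>*)\<close>, which is
  real-valued on antihermitian matrices; \<open>independent\<close> and \<open>span\<close> are over the reals.\<close>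

definition orthonormal_basis_antiherm :: "(complex^'d^'d) set \<Rightarrow> bool" where
  "orthonormal_basis_antiherm B \<longleftrightarrow>
     independent B \<and> span B = {W. antihermitian W} \<and>
     (\<forall>W\<in>B. \<forall>W'\<in>B. trace (W ** cadj W') = (if W = W' then 1 else 0))"

definition lie_deriv ::
  "complex^'d^'d \<Rightarrow> (complex^'d^'d \<Rightarrow> complex) \<Rightarrow> complex^'d^'d \<Rightarrow> complex" where
  "lie_deriv W f g = Lim (at (0::real)) (\<lambda>\<epsilon>. (f (mexp (\<epsilon> *\<^sub>R W) ** g) - f g) /\<^sub>R \<epsilon>)"

definition casimir ::
  "(complex^'d^'d) set \<Rightarrow> (complex^'d^'d \<Rightarrow> complex) \<Rightarrow> complex^'d^'d \<Rightarrow> complex" where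
  "casimir B f g = (\<Sum>W\<in>B. lie_deriv W (lie_deriv W f) g)"

definition casimir_coord ::
  "(complex^'d^'d) set \<Rightarrow> 'i \<Rightarrow> (('i \<Rightarrow> complex^'d^'d) \<Rightarrow> complex) \<Rightarrow>
   ('i \<Rightarrow> complex^'d^'d) \<Rightarrow> complex" where
  "casimir_coord B i F u = casimir B (\<lambda>g. F (u(i := g))) (u i)"

text \<open>\<open>mprod [M\<^sub>1, \<dots>, M\<^sub>n] = M\<^sub>1 ** \<dots> ** M\<^sub>n\<close>\<close>

definition mprod :: "(complex^'d^'d) list \<Rightarrow> complex^'d^'d" where
  "mprod Ms = foldr (**) Ms (mat 1)"

definition conj_class :: "complex^'d^'d \<Rightarrow> (complex^'d^'d) set" where
  "conj_class g = {k ** g ** matrix_inv k | k. k \<in> unitary_group}"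

definition rep :: "'a set \<Rightarrow> 'a" where
  "rep C = (SOME a. a \<in> C)"

definition class_trace :: "(complex^'d^'d) set \<Rightarrow> complex" where
  "class_trace C = trace (rep C)"


section \<open>Loops and collections\<close>

text \<open>A finite simple graph is a \<open>pair_graph\<close>: \<open>pverts G\<close> is \<open>X\<close> and the symmetric, irreflexive
  relation \<open>parcs G\<close> is the set \<open>E\<^sup>o\<close> of oriented edges.
  The based loop \<open>(\<xi>\<^sub>0, \<dots>, \<xi>\<^sub>p = \<xi>\<^sub>0)\<close> is encoded by the list \<open>[\<xi>\<^sub>0, \<dots>, \<xi>\<^bsub>p-1\<^esub>]\<close> with cyclic
  indices, so the empty list encodes every one-point loop.\<close>

definition nxt :: "'v list \<Rightarrow> nat \<Rightarrow> 'v" where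
  "nxt \<xi> i = \<xi> ! (Suc i mod length \<xi>)"

definition based_loops :: "'v pair_pre_digraph \<Rightarrow> 'v list set" where
  "based_loops G = {\<xi>. \<xi> \<noteq> [] \<and> (\<forall>i<length \<xi>. (\<xi> ! i, nxt \<xi> i) \<in> parcs G)}"

type_synonym 'v loop = "'v list set"

definition loop_of :: "'v list \<Rightarrow> 'v loop" where
  "loop_of \<xi> = {rotate k \<xi> | k. True}"

definition trivial_loop :: "'v loop" where
  "trivial_loop = loop_of []"

definition loops :: "'v pair_pre_digraph \<Rightarrow> 'v loop set" where
  "loops G = loop_of ` based_loops G"

definition nonbacktracking :: "'v list \<Rightarrow> bool" where
  "nonbacktracking \<xi> \<longleftrightarrow> (\<forall>i<length \<xi>. \<xi> ! i \<noteq> \<xi> ! ((i + 2) mod length \<xi>))"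

definition geodesic_loops :: "'v pair_pre_digraph \<Rightarrow> 'v loop set" where
  "geodesic_loops G = loop_of ` {\<xi> \<in> based_loops G. nonbacktracking \<xi>}"

text \<open>Removal of one pair of opposite consecutive edges \<open>(x,y), (y,x)\<close> from a loop. For
  \<open>zs = []\<close> the loop is \<open>(x,y,x)\<close> and the result is the trivial loop.\<close>

definition remove_pair :: "'v loop \<Rightarrow> 'v loop \<Rightarrow> bool" where
  "remove_pair l l' \<longleftrightarrow>
     (\<exists>x y zs. l = loop_of (x # y # zs) \<and> hd (zs @ [x]) = x \<and> l' = loop_of zs)"

text \<open>\<open>l\<^sup>R\<close>: the loop without backtracking obtained by iterated removal of such pairs. (It is
  unique.) A null-homotopic loop is reduced to the trivial loop.\<close>

definition reduced :: "'v loop \<Rightarrow> 'v loop" where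
  "reduced l = (SOME l'. remove_pair\<^sup>*\<^sup>* l l' \<and> l' \<in> loop_of ` Collect nonbacktracking)"

type_synonym 'v collection = "'v loop multiset"


section \<open>Occupation numbers\<close>

definition loop_cross :: "'v \<Rightarrow> 'v \<Rightarrow> 'v loop \<Rightarrow> nat" where
  "loop_cross x y l = (let \<xi> = rep l in card {i. i < length \<xi> \<and> \<xi> ! i = x \<and> nxt \<xi> i = y})"

definition loop_visits :: "'v pair_pre_digraph \<Rightarrow> 'v \<Rightarrow> 'v loop \<Rightarrow> nat" where
  "loop_visits G x l = (\<Sum>y\<in>pverts G. loop_cross x y l)"

definition N_edge :: "'v \<Rightarrow> 'v \<Rightarrow> 'v collection \<Rightarrow> nat" where
  "N_edge x y L = (\<Sum>l\<in>#L. loop_cross x y l)"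

definition N_vert :: "'v pair_pre_digraph \<Rightarrow> 'v \<Rightarrow> 'v collection \<Rightarrow> nat" where
  "N_vert G x L = (\<Sum>l\<in>#L. loop_visits G x l)"

definition flow :: "'v pair_pre_digraph \<Rightarrow> 'v collection \<Rightarrow> bool" where
  "flow G L \<longleftrightarrow> (\<forall>(x, y)\<in>parcs G. N_edge x y L * N_edge y x L = 0)"

text \<open>A choice of one orientation for each edge; sums over the unoriented edges \<open>{x,y}\<close> are
  written as sums over such an \<open>Or\<close>. The summands below are symmetric in \<open>x\<close> and \<open>y\<close>, so the
  sums do not depend on \<open>Or\<close>.\<close>

definition orientation :: "'v pair_pre_digraph \<Rightarrow> ('v \<times> 'v) set \<Rightarrow> bool" where
  "orientation G Or \<longleftrightarrow>
     Or \<subseteq> parcs G \<and> (\<forall>(x, y)\<in>parcs G. ((x, y) \<in> Or) \<noteq> ((y, x) \<in> Or))"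

definition S_occ :: "'v pair_pre_digraph \<Rightarrow> 'v collection \<Rightarrow> nat" where
  "S_occ G L = (\<Sum>x\<in>pverts G. N_vert G x L)"

definition V_occ :: "'v pair_pre_digraph \<Rightarrow> 'v collection \<Rightarrow> nat" where
  "V_occ G L = (\<Sum>x\<in>pverts G. (N_vert G x L)\<^sup>2)"

definition Vplus :: "('v \<times> 'v) set \<Rightarrow> 'v collection \<Rightarrow> nat" where
  "Vplus Or L = (\<Sum>(x, y)\<in>Or. (N_edge x y L)\<^sup>2 + (N_edge y x L)\<^sup>2)"

definition Vminus :: "('v \<times> 'v) set \<Rightarrow> 'v collection \<Rightarrow> nat" where
  "Vminus Or L = 2 * (\<Sum>(x, y)\<in>Or. N_edge x y L * N_edge y x L)"


section \<open>Split-and-merge operators\<close>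

text \<open>To speak about indices, the loops of a collection are listed (with multiplicity) and each
  is given a based representative. The laws of the outcomes below do not depend on these choices.
  An index of the collection is a pair (position in the listing, index in the based loop).\<close>

definition listing :: "'v collection \<Rightarrow> 'v list list" where
  "listing L = map rep (SOME ls. mset ls = L)"

definition visit_indices :: "'v \<Rightarrow> 'v list list \<Rightarrow> (nat \<times> nat) set" where
  "visit_indices x bs = {(a, i). a < length bs \<and> i < length (bs ! a) \<and> bs ! a ! i = x}"

definition crossing_indices :: "'v \<Rightarrow> 'v \<Rightarrow> 'v list list \<Rightarrow> (nat \<times> nat) set" where
  "crossing_indices x y bs =
     {(a, i). a < length bs \<and> i < length (bs ! a) \<and> bs ! a ! i = x \<and> nxt (bs ! a) i = y}"

text \<open>Both indices point to the same vertex. For two distinct indices on the same loop, \<open>\<xi>\<close> is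
  the loop based at the first and \<open>k\<close> is the position of the second on it.\<close>

definition split_merge :: "'v list list \<Rightarrow> nat \<times> nat \<Rightarrow> nat \<times> nat \<Rightarrow> 'v collection" where
  "split_merge bs = (\<lambda>(a, i) (b, j).
     let L = mset (map loop_of bs) in
     if a \<noteq> b then
       L - {#loop_of (bs ! a), loop_of (bs ! b)#}
         + {#loop_of (rotate i (bs ! a) @ rotate j (bs ! b))#}
     else if i \<noteq> j then
       (let p = length (bs ! a); \<xi> = rotate i (bs ! a); k = (j + p - i) mod p in
          L - {#loop_of (bs ! a)#} + {#loop_of (take k \<xi>), loop_of (drop k \<xi>)#})
     else L)"

text \<open>The indices \<open>(a,i)\<close> and \<open>(b,j)\<close> point to crossings of \<open>(x,y)\<close> and of \<open>(y,x)\<close>, which are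
  erased. On the same loop, based at the first crossing as
  \<open>\<xi> = [x, y, \<dots>, \<xi>\<^sub>k = y, \<xi>\<^bsub>k+1\<^esub> = x, \<dots>]\<close>, the bridges are \<open>\<xi>\<^sub>1, \<dots>, \<xi>\<^sub>k\<close> from \<open>y\<close> to \<open>y\<close> and
  \<open>\<xi>\<^bsub>k+1\<^esub>, \<dots>, \<xi>\<^sub>p\<close> from \<open>x\<close> to \<open>x\<close>. On different loops, the bridges from \<open>y\<close> to \<open>x\<close> and from
  \<open>x\<close> to \<open>y\<close> are concatenated and the loop so obtained is reduced.

  If a merged loop is reduced to the trivial loop and no other loop is left, the outcome is the
  empty collection (to which \<open>\<tau>\<close> gives the value \<open>d\<close>). If other loops are left, the trivial loop
  is kept as a member of the outcome: like the empty collection, it contributes the factor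
  \<open>Tr I = d\<close> to \<open>\<tau>\<close>. Discarding it there would lose that factor.\<close>

definition neg_split_merge :: "'v list list \<Rightarrow> nat \<times> nat \<Rightarrow> nat \<times> nat \<Rightarrow> 'v collection" where
  "neg_split_merge bs = (\<lambda>(a, i) (b, j).
     let L = mset (map loop_of bs) in
     if a = b then
       (let p = length (bs ! a); \<xi> = rotate i (bs ! a); k = (j + p - i) mod p in
          L - {#loop_of (bs ! a)#}
            + {#loop_of (take (k - 1) (tl \<xi>)), loop_of (drop (k + 1) \<xi>)#})
     else
       (let rest = L - {#loop_of (bs ! a), loop_of (bs ! b)#};
            l = reduced (loop_of (tl (rotate i (bs ! a)) @ tl (rotate j (bs ! b))))
        in if l = trivial_loop \<and> rest = {#} then {#} else add_mset l rest))"

text \<open>Transition kernels; they are only meaningful where the index sets are nonempty, that is,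
  where their rate in the operators below is nonzero.\<close>

definition Q_kernel :: "'v \<Rightarrow> 'v collection \<Rightarrow> 'v collection pmf" where
  "Q_kernel x L = (let bs = listing L; I = visit_indices x bs in
     map_pmf (\<lambda>(s, t). split_merge bs s t) (pair_pmf (pmf_of_set I) (pmf_of_set I)))"

definition Kplus_kernel :: "'v \<Rightarrow> 'v \<Rightarrow> 'v collection \<Rightarrow> 'v collection pmf" where
  "Kplus_kernel x y L = (let bs = listing L; I = crossing_indices x y bs in
     map_pmf (\<lambda>(s, t). split_merge bs s t) (pair_pmf (pmf_of_set I) (pmf_of_set I)))"

definition Kminus_kernel :: "'v \<Rightarrow> 'v \<Rightarrow> 'v collection \<Rightarrow> 'v collection pmf" where
  "Kminus_kernel x y L = (let bs = listing L in
     map_pmf (\<lambda>(s, t). neg_split_merge bs s t)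
       (pair_pmf (pmf_of_set (crossing_indices x y bs)) (pmf_of_set (crossing_indices y x bs))))"

definition kernel_act ::
  "('v collection \<Rightarrow> 'v collection pmf) \<Rightarrow> ('v collection \<Rightarrow> complex) \<Rightarrow>
   'v collection \<Rightarrow> complex" where
  "kernel_act K F L = (\<Sum>L'\<in>set_pmf (K L). complex_of_real (pmf (K L) L') * F L')"

definition B_SM ::
  "'v pair_pre_digraph \<Rightarrow> ('v collection \<Rightarrow> complex) \<Rightarrow> 'v collection \<Rightarrow> complex" where
  "B_SM G F L =
     (\<Sum>x\<in>pverts G. of_nat ((N_vert G x L)\<^sup>2) * (kernel_act (Q_kernel x) F L - F L))"

definition B_SM_plus ::
  "'v pair_pre_digraph \<Rightarrow> ('v collection \<Rightarrow> complex) \<Rightarrow> 'v collection \<Rightarrow> complex" where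
  "B_SM_plus G F L =
     (\<Sum>(x, y)\<in>parcs G. of_nat ((N_edge x y L)\<^sup>2) * (kernel_act (Kplus_kernel x y) F L - F L))"

definition B_SM_minus ::
  "'v pair_pre_digraph \<Rightarrow> ('v collection \<Rightarrow> complex) \<Rightarrow> 'v collection \<Rightarrow> complex" where
  "B_SM_minus G F L =
     (\<Sum>(x, y)\<in>parcs G. of_nat (N_edge x y L * N_edge y x L) *
        (kernel_act (Kminus_kernel x y) F L - F L))"


section \<open>Connections, gauge group and holonomies\<close>

definition gauge_group :: "'v pair_pre_digraph \<Rightarrow> ('v \<Rightarrow> complex^'d^'d) set" where
  "gauge_group G = pverts G \<rightarrow>\<^sub>E unitary_group"

definition connections :: "'v pair_pre_digraph \<Rightarrow> ('v \<times> 'v \<Rightarrow> complex^'d^'d) set" where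
  "connections G = {m \<in> parcs G \<rightarrow>\<^sub>E unitary_group.
     \<forall>(x, y)\<in>parcs G. m (x, y) = matrix_inv (m (y, x))}"

definition gauge_equiv ::
  "'v pair_pre_digraph \<Rightarrow> (('v \<times> 'v \<Rightarrow> complex^'d^'d) \<times> ('v \<times> 'v \<Rightarrow> complex^'d^'d)) set" where
  "gauge_equiv G = {(m, m') \<in> connections G \<times> connections G.
     \<exists>h\<in>gauge_group G. \<forall>(x, y)\<in>parcs G. m' (x, y) = matrix_inv (h y) ** m (x, y) ** h x}"

definition moduli :: "'v pair_pre_digraph \<Rightarrow> ('v \<times> 'v \<Rightarrow> complex^'d^'d) set set" where
  "moduli G = connections G // gauge_equiv G"

definition modulus ::
  "'v pair_pre_digraph \<Rightarrow> ('v \<times> 'v \<Rightarrow> complex^'d^'d) \<Rightarrow> ('v \<times> 'v \<Rightarrow> complex^'d^'d) set" where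
  "modulus G m = gauge_equiv G `` {m}"

definition path_holonomy :: "('v \<times> 'v \<Rightarrow> complex^'d^'d) \<Rightarrow> 'v list \<Rightarrow> complex^'d^'d" where
  "path_holonomy m \<xi> = mprod (rev (map (\<lambda>i. m (\<xi> ! i, nxt \<xi> i)) [0..<length \<xi>]))"

text \<open>Well defined: other representatives of the modulus and of the loop give conjugate matrices.\<close>

definition holonomy ::
  "('v \<times> 'v \<Rightarrow> complex^'d^'d) set \<Rightarrow> 'v loop \<Rightarrow> (complex^'d^'d) set" where
  "holonomy A l = conj_class (path_holonomy (rep A) (rep l))"

definition q_class :: "('v \<Rightarrow> complex^'d^'d) \<Rightarrow> 'v loop \<Rightarrow> (complex^'d^'d) set" where
  "q_class g l = conj_class (mprod (map g (rep l)))"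

definition tau :: "('v \<times> 'v \<Rightarrow> complex^'d^'d) set \<Rightarrow> 'v collection \<Rightarrow> complex" where
  "tau A L = (if L = {#} then of_nat CARD('d) else (\<Prod>l\<in>#L. class_trace (holonomy A l)))"

definition T_gauge :: "('v \<Rightarrow> complex^'d^'d) \<Rightarrow> 'v collection \<Rightarrow> complex" where
  "T_gauge g L = (\<Prod>l\<in>#L. class_trace (q_class g l))"


section \<open>Casimir operators on the gauge group and on connections\<close>

definition casimir_gauge ::
  "'v pair_pre_digraph \<Rightarrow> (complex^'d^'d) set \<Rightarrow> (('v \<Rightarrow> complex^'d^'d) \<Rightarrow> complex) \<Rightarrow>
   ('v \<Rightarrow> complex^'d^'d) \<Rightarrow> complex" where
  "casimir_gauge G B F g = (\<Sum>x\<in>pverts G. casimir_coord B x F g)"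

text \<open>Identification of \<open>U(d)\<^sup>E\<close> with the connections by means of the orientation \<open>Or\<close>; its inverse
  is the restriction to \<open>Or\<close>.\<close>

definition conn_of ::
  "('v \<times> 'v) set \<Rightarrow> ('v \<times> 'v \<Rightarrow> complex^'d^'d) \<Rightarrow> 'v \<times> 'v \<Rightarrow> complex^'d^'d" where
  "conn_of Or u = (\<lambda>(x, y).
     if (x, y) \<in> Or then u (x, y)
     else if (y, x) \<in> Or then matrix_inv (u (y, x))
     else undefined)"

definition casimir_conn ::
  "('v \<times> 'v) set \<Rightarrow> (complex^'d^'d) set \<Rightarrow> (('v \<times> 'v \<Rightarrow> complex^'d^'d) \<Rightarrow> complex) \<Rightarrow>
   ('v \<times> 'v \<Rightarrow> complex^'d^'d) \<Rightarrow> complex" where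
  "casimir_conn Or B F m =
     (\<Sum>e\<in>Or. casimir_coord B e (\<lambda>u. F (conn_of Or u)) (restrict m Or))"

end

theory Submission
  imports Defs
begin

text \<open>Both sides of each identity are finite sums over ordered pairs of places of the collection, and
  the identities hold pair by pair.

  Fix one coordinate \<open>g\<close>, that of a vertex or that of an edge. The trace function of a collection is
  then a product of traces of words whose letters are \<open>g\<close>, \<open>g\<^sup>-\<^sup>1\<close> or constants. Moving \<open>g\<close> along
  \<open>mexp (tW) g\<close> inserts \<open>W\<close> before a letter \<open>g\<close> and \<open>- W\<close> behind a letter \<open>g\<^sup>-\<^sup>1\<close>, so that the second
  derivative is a sum over ordered pairs of occurrences of \<open>g\<^sup>\<plusminus>\<^sup>1\<close>. Summation over an orthonormal basis
  of the antihermitian matrices contracts the two insertions by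
    \<open>\<Sum>\<^sub>W Tr (W X) Tr (W Y) = - Tr (X Y)\<close> and \<open>\<Sum>\<^sub>W Tr (W X W Y) = - Tr X Tr Y\<close>
  (\<open>casimir_merge\<close>, \<open>casimir_cut\<close>), which follow from the completeness of the basis. Hence two
  occurrences in different words merge these words, and two occurrences in one word cut it in two.
  A pair that consists of twice the same occurrence gives the factor \<open>d\<close>, the trace of the empty word.
  For occurrences of the same kind, both \<open>g\<close> or both \<open>g\<^sup>-\<^sup>1\<close>, this is exactly the split or merge of
  loops at a common vertex or edge; for opposite kinds the sign changes and the letters \<open>g\<close> and
  \<open>g\<^sup>-\<^sup>1\<close> become neighbours and cancel, which is the negative split or merge. This is
  \<open>casimir_words_trace\<close>.

  On the other side, a transition kernel that draws two independent uniform indices, multiplied by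
  its rate, is the sum over all pairs of indices (\<open>kernel_act_pair\<close>). The pairs of equal indices do
  not change the collection, which accounts for the difference between the factor \<open>d\<close> above and the
  factor \<open>d - 1\<close> in front of \<open>S\<close>; the identity operators subtracted from the kernels are
  compensated by \<open>V\<close>, respectively by \<open>V\<^sup>+\<close> and \<open>V\<^sup>-\<close>.

  It remains to see that the trace functions do not depend on the choices of representatives: the
  trace is invariant under rotations of a loop, under gauge transformations
  (\<open>trace_path_holonomy_gauge\<close>) and under removal of backtracking (\<open>reduced_invariant\<close>).\<close>

section \<open>Unitary matrices, traces and the matrix exponential\<close>

lemma cadj_mult: "cadj (A ** B) = cadj B ** cadj (A::complex^'d^'d)"
  by (simp add: cadj_def matrix_matrix_mult_def vec_eq_iff mult.commute)

lemma cadj_cadj [simp]: "cadj (cadj A) = (A::complex^'d^'d)"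
  by (simp add: cadj_def vec_eq_iff)

lemma cadj_one [simp]: "cadj (mat 1 :: complex^'d^'d) = mat 1"
  by (simp add: cadj_def mat_def vec_eq_iff)

lemma trace_cadj: "trace (cadj A) = cnj (trace (A::complex^'d^'d))"
  by (simp add: cadj_def trace_def)

lemma bounded_linear_cadj: "bounded_linear (cadj :: complex^'d^'d \<Rightarrow> _)"
  by (subst linear_conv_bounded_linear[symmetric], rule linearI)
     (simp_all add: cadj_def vec_eq_iff scaleR_conv_of_real[where 'a = complex])

lemma bounded_linear_trace: "bounded_linear (trace :: complex^'d^'d \<Rightarrow> complex)"
  by (subst linear_conv_bounded_linear[symmetric], rule linearI)
     (simp_all add: trace_def sum.distrib scaleR_right.sum)

lemma bounded_bilinear_matrix_mult:
  "bounded_bilinear ((**) :: complex^'d^'d \<Rightarrow> complex^'d^'d \<Rightarrow> complex^'d^'d)"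
  by (subst bilinear_conv_bounded_bilinear[symmetric])
     (auto simp: bilinear_def intro!: linearI
       simp: matrix_matrix_mult_def vec_eq_iff algebra_simps sum.distrib scaleR_right.sum)

interpretation matrix_mult:
  bounded_bilinear "(**) :: complex^'d^'d \<Rightarrow> complex^'d^'d \<Rightarrow> complex^'d^'d"
  by (rule bounded_bilinear_matrix_mult)

lemmas trace_has_vector_derivative =
  bounded_linear.has_vector_derivative[OF bounded_linear_trace]

lemma unitary_cancel:
  assumes "(g::complex^'d^'d) \<in> unitary_group"
  shows "cadj g ** g = mat 1" "g ** cadj g = mat 1"
  using assms by (auto simp: unitary_group_def)

lemma unitary_one: "mat 1 \<in> (unitary_group :: (complex^'d^'d) set)"
  by (simp add: unitary_group_def matrix_mul_lid)

lemma unitary_cadj: "g \<in> unitary_group \<Longrightarrow> cadj g \<in> (unitary_group :: (complex^'d^'d) set)"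
  by (simp add: unitary_group_def)

lemma unitary_mult:
  assumes "g \<in> unitary_group" "h \<in> (unitary_group :: (complex^'d^'d) set)"
  shows "g ** h \<in> unitary_group"
proof -
  have "cadj (g ** h) ** (g ** h) = cadj h ** (cadj g ** g) ** h"
    by (simp add: cadj_mult matrix_mul_assoc)
  moreover have "(g ** h) ** cadj (g ** h) = g ** (h ** cadj h) ** cadj g"
    by (simp add: cadj_mult matrix_mul_assoc)
  ultimately show ?thesis
    using assms by (simp add: unitary_group_def matrix_mul_lid matrix_mul_rid)
qed

lemma matrix_inv_unitary:
  assumes "g \<in> (unitary_group :: (complex^'d^'d) set)"
  shows "matrix_inv g = cadj g"
proof -
  have "g ** matrix_inv g = mat 1 \<and> matrix_inv g ** g = mat 1"
    unfolding matrix_inv_def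
    by (rule someI_ex) (use unitary_cancel[OF assms] in blast)
  then have "g ** matrix_inv g = mat 1" by blast
  then have "cadj g ** (g ** matrix_inv g) = cadj g"
    by (simp only: matrix_mul_rid)
  then show ?thesis
    using unitary_cancel[OF assms] by (simp add: matrix_mul_assoc matrix_mul_lid)
qed

text \<open>Conjugate matrices have the same trace, so the choice of an element of the class is harmless.\<close>

lemma class_trace_conj_class: "class_trace (conj_class g) = trace (g :: complex^'d^'d)"
proof -
  have "g \<in> conj_class g"
    unfolding conj_class_def
    by (rule CollectI, rule exI[of _ "mat 1"])
       (simp add: unitary_one matrix_inv_unitary matrix_mul_lid matrix_mul_rid)
  then have "rep (conj_class g) \<in> conj_class g"
    unfolding rep_def by (rule someI)
  then obtain k where k: "k \<in> unitary_group" "rep (conj_class g) = k ** g ** cadj k"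
    by (auto simp: conj_class_def matrix_inv_unitary)
  have "trace (k ** g ** cadj k) = trace (cadj k ** (k ** g))"
    by (rule trace_mul_sym)
  also have "\<dots> = trace g"
    using unitary_cancel[OF k(1)] by (simp add: matrix_mul_assoc matrix_mul_lid)
  finally show ?thesis using k by (simp add: class_trace_def)
qed

lemma mprod_Nil [simp]: "mprod [] = mat 1"
  by (simp add: mprod_def)

lemma mprod_Cons [simp]: "mprod (A # As) = A ** mprod As"
  by (simp add: mprod_def)

lemma mprod_append: "mprod (As @ Bs) = mprod As ** mprod (Bs :: (complex^'d^'d) list)"
  by (induction As) (simp_all add: matrix_mul_lid matrix_mul_assoc)

lemma cadj_mprod: "cadj (mprod As) = mprod (rev (map cadj (As :: (complex^'d^'d) list)))"
  by (induction As) (simp_all add: cadj_mult mprod_append matrix_mul_rid)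

lemma mpow_0 [simp]: "mpow M 0 = mat 1"
  by (simp add: mpow_def)

lemma mpow_Suc: "mpow M (Suc n) = M ** mpow M n"
  by (simp add: mpow_def)

lemma mpow_scaleR: "mpow (t *\<^sub>R W) n = t ^ n *\<^sub>R mpow (W :: complex^'d^'d) n"
  by (induction n) (simp_all add: mpow_Suc matrix_mult.scaleR_left matrix_mult.scaleR_right)

text \<open>Each entry of \<open>\<epsilon> \<mapsto> mexp (\<epsilon>W)\<close> is an everywhere convergent power series, because the
  entries of \<open>W\<^sup>n\<close> grow at most geometrically; hence the series may be differentiated term by term.\<close>

lemma norm_mpow_entry:
  fixes W :: "complex^'d^'d"
  defines "C \<equiv> (\<Sum>i\<in>UNIV. \<Sum>j\<in>UNIV. norm (W $ i $ j))"
  shows "norm (mpow W n $ i $ j) \<le> C ^ n"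
proof (induction n arbitrary: i j)
  case 0
  then show ?case by (simp add: mat_def)
next
  case (Suc n)
  have "norm (mpow W (Suc n) $ i $ j) \<le> (\<Sum>k\<in>UNIV. norm (W $ i $ k * mpow W n $ k $ j))"
    by (simp add: mpow_Suc matrix_matrix_mult_def norm_sum)
  also have "\<dots> \<le> (\<Sum>k\<in>UNIV. norm (W $ i $ k) * C ^ n)"
    by (intro sum_mono) (simp add: norm_mult mult_left_mono Suc)
  also have "\<dots> = (\<Sum>k\<in>UNIV. norm (W $ i $ k)) * C ^ n"
    by (simp add: sum_distrib_right)
  also have "\<dots> \<le> C * C ^ n"
  proof (intro mult_right_mono)
    have "(\<Sum>k\<in>UNIV. norm (W $ i $ k)) \<le> (\<Sum>i\<in>UNIV. \<Sum>j\<in>UNIV. norm (W $ i $ j))"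
      by (rule member_le_sum[of i UNIV "\<lambda>i. \<Sum>j\<in>UNIV. norm (W $ i $ j)"])
         (auto intro: sum_nonneg)
    then show "(\<Sum>k\<in>UNIV. norm (W $ i $ k)) \<le> C" by (simp add: C_def)
    show "0 \<le> C ^ n" by (auto simp: C_def intro!: zero_le_power sum_nonneg)
  qed
  finally show ?case by simp
qed

lemma summable_exp_entry:
  fixes W :: "complex^'d^'d" and z :: complex
  shows "summable (\<lambda>n. mpow W n $ i $ j / fact n * z ^ n)"
proof -
  define C where "C = (\<Sum>i\<in>UNIV. \<Sum>j\<in>UNIV. norm (W $ i $ j))"
  show ?thesis
  proof (rule summable_comparison_test)
    show "\<exists>N. \<forall>n\<ge>N. norm (mpow W n $ i $ j / fact n * z ^ n) \<le> (C * norm z) ^ n /\<^sub>R fact n"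
      using norm_mpow_entry[of W _ i j]
      by (auto simp: norm_mult norm_divide norm_power C_def divide_simps power_mult_distrib
          intro!: mult_right_mono)
    show "summable (\<lambda>n. (C * norm z) ^ n /\<^sub>R fact n)"
      by (rule summable_exp_generic)
  qed
qed

lemma mexp_scaleR_entry:
  fixes W :: "complex^'d^'d" and t :: real
  shows "mexp (t *\<^sub>R W) $ i $ j = (\<Sum>n. mpow W n $ i $ j / fact n * of_real t ^ n)"
proof -
  let ?f = "\<lambda>n. mpow (t *\<^sub>R W) n /\<^sub>R fact n"
  have entry: "?f n $ i $ j = mpow W n $ i $ j / fact n * of_real t ^ n" for n i j
    by (simp add: mpow_scaleR scaleR_conv_of_real[where 'a = complex] field_simps)
  have "(\<lambda>n. ?f n) sums (\<chi> i j. \<Sum>n. mpow W n $ i $ j / fact n * of_real t ^ n)"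
    unfolding sums_def
  proof (intro vec_tendstoI)
    fix i j
    have "(\<lambda>n. ?f n $ i $ j) sums (\<Sum>n. mpow W n $ i $ j / fact n * of_real t ^ n)"
      unfolding entry by (intro summable_sums summable_exp_entry)
    then show "(\<lambda>n. sum ?f {..<n} $ i $ j) \<longlonglongrightarrow>
        (\<chi> i j. \<Sum>n. mpow W n $ i $ j / fact n * of_real t ^ n) $ i $ j"
      by (simp add: sums_def)
  qed
  then show ?thesis
    by (simp add: mexp_def sums_iff)
qed

lemma has_vector_derivative_vec_lambda:
  fixes f :: "real \<Rightarrow> 'a::real_normed_vector^'n"
  assumes "\<And>i. ((\<lambda>t. f t $ i) has_vector_derivative f' $ i) (at t)"
  shows "(f has_vector_derivative f') (at t)"
proof -
  have "((\<lambda>y. (f y - f t - (y - t) *\<^sub>R f') /\<^sub>R norm (y - t)) \<longlongrightarrow> 0) (at t)"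
    by (rule vec_tendstoI)
       (use assms in \<open>simp add: has_vector_derivative_def has_derivative_at_within has_derivative_within\<close>)
  then show ?thesis
    by (simp add: has_vector_derivative_def has_derivative_within bounded_linear_scaleR_left
        diff_diff_eq divide_inverse_commute)
qed

lemma mexp_has_vector_derivative:
  fixes W :: "complex^'d^'d"
  shows "((\<lambda>t. mexp (t *\<^sub>R W)) has_vector_derivative W ** mexp (t *\<^sub>R W)) (at t)"
proof (intro has_vector_derivative_vec_lambda)
  fix i j
  let ?c = "\<lambda>n. mpow W n $ i $ j / fact n"
  have "DERIV (\<lambda>z. \<Sum>n. ?c n * z ^ n) (of_real t) :> (\<Sum>n. diffs ?c n * of_real t ^ n)"
    by (rule termdiffs_strong_converges_everywhere) (rule summable_exp_entry)
  also have "(\<Sum>n. diffs ?c n * of_real t ^ n)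
      = (\<Sum>n. \<Sum>k\<in>UNIV. W $ i $ k * (mpow W n $ k $ j / fact n * of_real t ^ n))"
  proof -
    have "diffs ?c n = (\<Sum>k\<in>UNIV. W $ i $ k * mpow W n $ k $ j) / fact n" for n
      by (simp add: diffs_def mpow_Suc matrix_matrix_mult_def del: of_nat_Suc)
    then show ?thesis
      by (simp add: sum_divide_distrib sum_distrib_right mult.assoc)
  qed
  also have "\<dots> = (W ** mexp (t *\<^sub>R W)) $ i $ j"
  proof -
    have "summable (\<lambda>n. W $ i $ k * (mpow W n $ k $ j / fact n * of_real t ^ n))" for k
      by (intro summable_mult summable_exp_entry)
    then have "(\<Sum>n. \<Sum>k\<in>UNIV. W $ i $ k * (mpow W n $ k $ j / fact n * of_real t ^ n))
        = (\<Sum>k\<in>UNIV. \<Sum>n. W $ i $ k * (mpow W n $ k $ j / fact n * of_real t ^ n))"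
      by (intro suminf_sum) auto
    also have "\<dots> = (\<Sum>k\<in>UNIV. W $ i $ k * (\<Sum>n. mpow W n $ k $ j / fact n * of_real t ^ n))"
      by (intro sum.cong refl suminf_mult summable_exp_entry)
    finally show ?thesis
      by (simp add: mexp_scaleR_entry matrix_matrix_mult_def)
  qed
  finally show "((\<lambda>t. mexp (t *\<^sub>R W) $ i $ j) has_vector_derivative
      (W ** mexp (t *\<^sub>R W)) $ i $ j) (at t)"
    unfolding mexp_scaleR_entry by (rule has_vector_derivative_real_field)
qed

lemma mexp_zero [simp]: "mexp (0 :: complex^'d^'d) = mat 1"
proof -
  have "mexp (0 *\<^sub>R (0 :: complex^'d^'d)) $ i $ j = mat 1 $ i $ j" for i j :: 'd
    by (simp only: mexp_scaleR_entry of_real_0 powser_zero) simp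
  then show ?thesis by (simp add: vec_eq_iff)
qed

text \<open>For antihermitian \<open>W\<close> the derivative of \<open>E\<^sup>* E\<close> along \<open>E = mexp (tW)\<close> is
  \<open>E\<^sup>* (W\<^sup>* + W) E = 0\<close>, so \<open>E\<^sup>* E\<close> keeps its value at \<open>t = 0\<close>.\<close>

lemma mexp_unitary:
  fixes W :: "complex^'d^'d"
  assumes "antihermitian W"
  shows "mexp (t *\<^sub>R W) \<in> unitary_group"
proof -
  let ?E = "\<lambda>t. mexp (t *\<^sub>R W)"
  have "((\<lambda>t. cadj (?E t) ** ?E t) has_vector_derivative 0) (at t)" for t
  proof -
    have "((\<lambda>t. cadj (?E t) ** ?E t) has_vector_derivative
        cadj (?E t) ** (W ** ?E t) + cadj (W ** ?E t) ** ?E t) (at t)"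
      by (intro matrix_mult.has_vector_derivative mexp_has_vector_derivative
          bounded_linear.has_vector_derivative[OF bounded_linear_cadj])
    moreover have "cadj (W ** ?E t) ** ?E t = - (cadj (?E t) ** (W ** ?E t))"
      using assms by (simp add: antihermitian_def cadj_mult matrix_mult.minus_left
          matrix_mult.minus_right matrix_mul_assoc)
    ultimately show ?thesis by simp
  qed
  then obtain c where c: "\<And>t. cadj (?E t) ** ?E t = c"
    using has_vector_derivative_zero_constant[of UNIV "\<lambda>t. cadj (?E t) ** ?E t"] by auto
  from c[of 0] have "c = mat 1" by (simp add: matrix_mul_lid)
  with c[of t] have "cadj (?E t) ** ?E t = mat 1" by simp
  then show ?thesis
    using matrix_left_right_inverse by (auto simp: unitary_group_def)
qed


section \<open>Completeness of an orthonormal basis of antihermitian matrices\<close>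

lemma finite_orthonormal_basis_antiherm:
  "orthonormal_basis_antiherm (B :: (complex^'d^'d) set) \<Longrightarrow> finite B"
  by (auto simp: orthonormal_basis_antiherm_def intro: independent_imp_finite)

lemma antihermitian_of_basis:
  "\<lbrakk>orthonormal_basis_antiherm (B :: (complex^'d^'d) set); W \<in> B\<rbrakk> \<Longrightarrow> antihermitian W"
  unfolding orthonormal_basis_antiherm_def using span_base by blast

text \<open>Expanding an antihermitian matrix in the basis gives \<open>X = - \<Sum>\<^sub>W Tr (X W) W\<close>. Both sides are
  complex linear in \<open>X\<close>, and every matrix is \<open>Y + \<i> Z\<close> with \<open>Y\<close> and \<open>Z\<close> antihermitian, so the
  expansion holds for all matrices.\<close>

lemma antihermitian_expansion:
  fixes X :: "complex^'d^'d"
  assumes B: "orthonormal_basis_antiherm B" and X: "antihermitian X"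
  shows "X $ i $ j = - (\<Sum>W\<in>B. trace (X ** W) * W $ i $ j)"
proof -
  have fin: "finite B" by (rule finite_orthonormal_basis_antiherm[OF B])
  have "X \<in> span B"
    using B X by (simp add: orthonormal_basis_antiherm_def)
  then obtain r where r: "X = (\<Sum>W\<in>B. r W *\<^sub>R W)"
    unfolding span_finite[OF fin] by auto
  have coeff: "trace (X ** W) = - of_real (r W)" if "W \<in> B" for W
  proof -
    have "cadj W = - W"
      using antihermitian_of_basis[OF B that] by (simp add: antihermitian_def)
    then have "trace (X ** W) = - trace (X ** cadj W)"
      by (simp add: matrix_mult.minus_right linear_neg[OF bounded_linear.linear[OF bounded_linear_trace]])
    also have "trace (X ** cadj W) = (\<Sum>W'\<in>B. r W' *\<^sub>R trace (W' ** cadj W))"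
      by (simp add: r matrix_mult.sum_left matrix_mult.scaleR_left
          linear_sum[OF bounded_linear.linear[OF bounded_linear_trace]]
          linear_cmul[OF bounded_linear.linear[OF bounded_linear_trace]])
    also have "\<dots> = (\<Sum>W'\<in>B. if W' = W then of_real (r W) else 0)"
      using B that by (intro sum.cong) (auto simp: orthonormal_basis_antiherm_def scaleR_conv_of_real)
    finally show ?thesis using fin that by simp
  qed
  have "- (\<Sum>W\<in>B. trace (X ** W) * W $ i $ j) = (\<Sum>W\<in>B. of_real (r W) * W $ i $ j)"
    by (simp add: coeff sum_negf)
  also have "\<dots> = X $ i $ j"
    by (simp add: r scaleR_conv_of_real[where 'a = complex])
  finally show ?thesis by simp
qed

lemma matrix_expansion:
  fixes X :: "complex^'d^'d"
  assumes B: "orthonormal_basis_antiherm B"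
  shows "X $ i $ j = - (\<Sum>W\<in>B. trace (X ** W) * W $ i $ j)"
proof -
  define Y where "Y = (\<chi> i j. (X $ i $ j - cnj (X $ j $ i)) / 2)"
  define Z where "Z = (\<chi> i j. - \<i> * (X $ i $ j + cnj (X $ j $ i)) / 2)"
  have "antihermitian Y" "antihermitian Z"
    by (auto simp: antihermitian_def cadj_def Y_def Z_def vec_eq_iff field_simps)
  note YZ = this[THEN antihermitian_expansion[OF B]]
  have X: "X $ i $ j = Y $ i $ j + \<i> * Z $ i $ j" for i j
    by (simp add: Y_def Z_def field_simps)
  have tr: "trace (X ** W) = trace (Y ** W) + \<i> * trace (Z ** W)" for W
    by (simp add: trace_def matrix_matrix_mult_def X sum.distrib sum_distrib_left algebra_simps)
  show ?thesis
    by (subst X, subst YZ, subst YZ, simp add: tr sum.distrib sum_distrib_left algebra_simps)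
qed

text \<open>The expansion of the matrix unit \<open>X\<close> with entry \<open>1\<close> at \<open>(l, k)\<close>, for which \<open>Tr (X W) = W\<^sub>k\<^sub>l\<close>.\<close>

lemma casimir_entries:
  fixes B :: "(complex^'d^'d) set"
  assumes B: "orthonormal_basis_antiherm B"
  shows "(\<Sum>W\<in>B. W $ i $ j * W $ k $ l) = (if i = l \<and> j = k then -1 else 0)"
proof -
  define X :: "complex^'d^'d" where "X = (\<chi> a b. if a = l \<and> b = k then 1 else 0)"
  have "trace (X ** W) = W $ k $ l" for W
  proof -
    have "trace (X ** W) = (\<Sum>a\<in>UNIV. \<Sum>b\<in>UNIV. X $ a $ b * W $ b $ a)"
      by (simp add: trace_def matrix_matrix_mult_def)
    also have "\<dots> = (\<Sum>a\<in>UNIV. \<Sum>b\<in>UNIV. if b = k then (if a = l then W $ b $ a else 0) else 0)"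
      unfolding X_def by (intro sum.cong) auto
    finally show ?thesis by (simp add: sum.delta)
  qed
  with matrix_expansion[OF B, of X i j]
  have "(\<Sum>W\<in>B. W $ i $ j * W $ k $ l) = - X $ i $ j"
    by (simp add: mult.commute)
  then show ?thesis by (simp add: X_def)
qed

text \<open>The two contractions behind merging and splitting: a pair of insertions of the basis into
  two traces joins them, a pair of insertions into one trace cuts it in two.\<close>

lemma casimir_merge:
  fixes X Y :: "complex^'d^'d"
  assumes B: "orthonormal_basis_antiherm B"
  shows "(\<Sum>W\<in>B. trace (W ** X) * trace (W ** Y)) = - trace (X ** Y)"
proof -
  have "(\<Sum>W\<in>B. trace (W ** X) * trace (W ** Y))
      = (\<Sum>W\<in>B. \<Sum>i\<in>UNIV. \<Sum>j\<in>UNIV. (trace (X ** W) * W $ i $ j) * Y $ j $ i)"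
  proof -
    have "trace (W ** Y) = (\<Sum>i\<in>UNIV. \<Sum>j\<in>UNIV. W $ i $ j * Y $ j $ i)" for W
      by (simp add: trace_def matrix_matrix_mult_def)
    then show ?thesis
      by (simp add: trace_mul_sym[of _ X] sum_distrib_left mult.assoc)
  qed
  also have "\<dots> = (\<Sum>i\<in>UNIV. \<Sum>W\<in>B. \<Sum>j\<in>UNIV. (trace (X ** W) * W $ i $ j) * Y $ j $ i)"
    by (rule sum.swap)
  also have "\<dots> = (\<Sum>i\<in>UNIV. \<Sum>j\<in>UNIV. \<Sum>W\<in>B. (trace (X ** W) * W $ i $ j) * Y $ j $ i)"
    by (intro sum.cong refl sum.swap)
  also have "\<dots> = (\<Sum>i\<in>UNIV. \<Sum>j\<in>UNIV. - (X $ i $ j) * Y $ j $ i)"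
    by (subst matrix_expansion[OF B, of X]) (simp add: sum_distrib_right)
  also have "\<dots> = - trace (X ** Y)"
    by (simp add: trace_def matrix_matrix_mult_def sum_negf)
  finally show ?thesis .
qed

lemma casimir_cut:
  fixes X Y :: "complex^'d^'d"
  assumes B: "orthonormal_basis_antiherm B"
  shows "(\<Sum>W\<in>B. trace (W ** X ** W ** Y)) = - (trace X * trace Y)"
proof -
  have "(\<Sum>W\<in>B. trace (W ** X ** W ** Y))
      = (\<Sum>W\<in>B. \<Sum>i\<in>UNIV. \<Sum>j\<in>UNIV. \<Sum>k\<in>UNIV. \<Sum>l\<in>UNIV.
          (W $ i $ l * W $ k $ j) * X $ l $ k * Y $ j $ i)"
    by (simp add: trace_def matrix_matrix_mult_def sum_distrib_left sum_distrib_right ac_simps)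
  also have "\<dots> = (\<Sum>i\<in>UNIV. \<Sum>j\<in>UNIV. \<Sum>k\<in>UNIV. \<Sum>l\<in>UNIV. \<Sum>W\<in>B.
          (W $ i $ l * W $ k $ j) * X $ l $ k * Y $ j $ i)"
    by (simp only: sum.swap[of _ _ B])
  also have "\<dots> = (\<Sum>i\<in>UNIV. \<Sum>j\<in>UNIV. \<Sum>k\<in>UNIV. \<Sum>l\<in>UNIV.
          (if i = j \<and> l = k then -1 else 0) * X $ l $ k * Y $ j $ i)"
    by (simp only: casimir_entries[OF B] flip: sum_distrib_right)
  also have "\<dots> = (\<Sum>i\<in>UNIV. \<Sum>j\<in>UNIV. \<Sum>k\<in>UNIV. \<Sum>l\<in>UNIV.
          if l = k then if i = j then - (X $ k $ k * Y $ i $ i) else 0 else 0)"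
    by (intro sum.cong) auto
  also have "\<dots> = - (trace X * trace Y)"
  proof -
    have "(\<Sum>j\<in>UNIV. \<Sum>k\<in>UNIV. if i = j then - (X $ k $ k * Y $ i $ i) else 0)
        = - (trace X * Y $ i $ i)" for i
      by (subst sum.swap) (simp add: trace_def sum_negf sum_distrib_right)
    then show ?thesis
      by (simp add: sum_negf trace_def[of Y] sum_distrib_left)
  qed
  finally show ?thesis .
qed

section \<open>Lie derivatives on the unitary group\<close>

text \<open>Only the values on the unitary group matter, since \<open>mexp (tW)\<close> is unitary; the relational form
  makes the usual rules for derivatives available and can be iterated.\<close>

definition has_lie_deriv ::
  "complex^'d^'d \<Rightarrow> (complex^'d^'d \<Rightarrow> complex) \<Rightarrow> (complex^'d^'d \<Rightarrow> complex) \<Rightarrow> bool" where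
  "has_lie_deriv W f f' \<longleftrightarrow>
     (\<forall>g\<in>unitary_group. ((\<lambda>t. f (mexp (t *\<^sub>R W) ** g)) has_vector_derivative f' g) (at 0))"

lemma lie_deriv_eqI:
  fixes g :: "complex^'d^'d"
  assumes "has_lie_deriv W f f'" "g \<in> unitary_group"
  shows "lie_deriv W f g = f' g"
proof -
  let ?F = "\<lambda>t. f (mexp (t *\<^sub>R W) ** g)"
  have "(?F has_vector_derivative f' g) (at 0)"
    using assms by (auto simp: has_lie_deriv_def)
  then have "((\<lambda>t. (?F t - ?F 0 - t *\<^sub>R f' g) /\<^sub>R norm t) \<longlongrightarrow> 0) (at 0)"
    unfolding has_vector_derivative_def has_derivative_within
    by (simp add: diff_diff_eq divide_inverse_commute)
  then have "((\<lambda>t. norm ((?F t - ?F 0 - t *\<^sub>R f' g) /\<^sub>R norm t)) \<longlongrightarrow> 0) (at 0)"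
    by (rule tendsto_norm_zero)
  also have "?this \<longleftrightarrow> ((\<lambda>t. norm ((?F t - ?F 0) /\<^sub>R t - f' g)) \<longlongrightarrow> 0) (at 0)"
  proof (intro filterlim_cong refl)
    have "norm ((?F t - ?F 0 - t *\<^sub>R f' g) /\<^sub>R norm t) = norm ((?F t - ?F 0) /\<^sub>R t - f' g)"
      if "t \<noteq> 0" for t :: real
    proof -
      have "(?F t - ?F 0) /\<^sub>R t - f' g = (?F t - ?F 0 - t *\<^sub>R f' g) /\<^sub>R t"
        using that by (simp add: scaleR_diff_right)
      then show ?thesis by simp
    qed
    then show "\<forall>\<^sub>F t in at 0. norm ((?F t - ?F 0 - t *\<^sub>R f' g) /\<^sub>R norm t)
        = norm ((?F t - ?F 0) /\<^sub>R t - f' g)"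
      by (auto simp: eventually_at_filter)
  qed
  finally have "((\<lambda>t. (?F t - ?F 0) /\<^sub>R t) \<longlongrightarrow> f' g) (at 0)"
    by (rule LIM_zero_cancel[OF tendsto_norm_zero_cancel])
  then show ?thesis
    unfolding lie_deriv_def by (intro tendsto_Lim) (simp_all add: matrix_mul_lid)
qed

lemma lie_deriv_cong:
  fixes g :: "complex^'d^'d"
  assumes "antihermitian W" "g \<in> unitary_group" "\<And>g. g \<in> unitary_group \<Longrightarrow> f g = f' g"
  shows "lie_deriv W f g = lie_deriv W f' g"
  using assms by (simp add: lie_deriv_def mexp_unitary unitary_mult)

lemma casimir_cong:
  fixes g :: "complex^'d^'d"
  assumes "orthonormal_basis_antiherm B" "g \<in> unitary_group"
    and "\<And>g. g \<in> unitary_group \<Longrightarrow> f g = f' g"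
  shows "casimir B f g = casimir B f' g"
  unfolding casimir_def using assms
  by (intro sum.cong refl lie_deriv_cong antihermitian_of_basis[OF assms(1)]) auto

lemma casimir_eqI:
  fixes g :: "complex^'d^'d"
  assumes "orthonormal_basis_antiherm B" "g \<in> unitary_group"
    and "\<And>W. antihermitian W \<Longrightarrow> has_lie_deriv W f (f1 W)"
    and "\<And>W. antihermitian W \<Longrightarrow> has_lie_deriv W (f1 W) (f2 W)"
  shows "casimir B f g = (\<Sum>W\<in>B. f2 W g)"
  unfolding casimir_def
proof (intro sum.cong refl)
  fix W assume "W \<in> B"
  then have W: "antihermitian W" by (rule antihermitian_of_basis[OF assms(1)])
  have "lie_deriv W (lie_deriv W f) g = lie_deriv W (f1 W) g"
    by (rule lie_deriv_cong[OF W assms(2)]) (rule lie_deriv_eqI[OF assms(3)[OF W]])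
  also have "\<dots> = f2 W g"
    by (rule lie_deriv_eqI[OF assms(4)[OF W] assms(2)])
  finally show "lie_deriv W (lie_deriv W f) g = f2 W g" .
qed

lemma has_lie_deriv_cnj:
  "has_lie_deriv W f f' \<Longrightarrow> has_lie_deriv W (\<lambda>g. cnj (f g)) (\<lambda>g. cnj (f' g))"
  by (auto simp: has_lie_deriv_def intro: has_vector_derivative_cnj)

lemma has_lie_deriv_sum:
  "(\<And>i. i \<in> I \<Longrightarrow> has_lie_deriv W (f i) (f' i)) \<Longrightarrow>
    has_lie_deriv W (\<lambda>g. \<Sum>i\<in>I. f i g) (\<lambda>g. \<Sum>i\<in>I. f' i g)"
  by (auto simp: has_lie_deriv_def intro: has_vector_derivative_sum)

lemma has_lie_deriv_scaleR:
  "has_lie_deriv W f f' \<Longrightarrow> has_lie_deriv W (\<lambda>g. c *\<^sub>R f g) (\<lambda>g. c *\<^sub>R f' g)"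
  by (auto simp: has_lie_deriv_def
      intro: bounded_linear.has_vector_derivative[OF bounded_linear_scaleR_right])

lemma has_lie_deriv_mult:
  fixes W :: "complex^'d^'d"
  assumes "has_lie_deriv W f f'" "has_lie_deriv W h h'"
  shows "has_lie_deriv W (\<lambda>g. f g * h g) (\<lambda>g. f' g * h g + f g * h' g)"
  unfolding has_lie_deriv_def
proof
  fix g :: "complex^'d^'d" assume "g \<in> unitary_group"
  with assms have "((\<lambda>t. f (mexp (t *\<^sub>R W) ** g) * h (mexp (t *\<^sub>R W) ** g)) has_vector_derivative
      f (mexp (0 *\<^sub>R W) ** g) * h' g + f' g * h (mexp (0 *\<^sub>R W) ** g)) (at 0)"
    by (intro has_vector_derivative_mult) (auto simp: has_lie_deriv_def)
  then show "((\<lambda>t. f (mexp (t *\<^sub>R W) ** g) * h (mexp (t *\<^sub>R W) ** g)) has_vector_derivative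
      f' g * h g + f g * h' g) (at 0)"
    by (simp add: matrix_mul_lid add.commute)
qed

lemma has_lie_deriv_prod:
  assumes "finite I" "\<And>i. i \<in> I \<Longrightarrow> has_lie_deriv W (f i) (f' i)"
  shows "has_lie_deriv W (\<lambda>g. \<Prod>i\<in>I. f i g) (\<lambda>g. \<Sum>i\<in>I. f' i g * (\<Prod>j\<in>I - {i}. f j g))"
  using assms
proof (induction I rule: finite_induct)
  case empty
  then show ?case by (simp add: has_lie_deriv_def)
next
  case (insert k I)
  have "has_lie_deriv W (\<lambda>g. f k g * (\<Prod>i\<in>I. f i g))
      (\<lambda>g. f' k g * (\<Prod>i\<in>I. f i g) + f k g * (\<Sum>i\<in>I. f' i g * (\<Prod>j\<in>I - {i}. f j g)))"
    by (intro has_lie_deriv_mult) (use insert in auto)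
  moreover have "(\<Sum>i\<in>I. f' i g * (\<Prod>j\<in>insert k I - {i}. f j g))
      = f k g * (\<Sum>i\<in>I. f' i g * (\<Prod>j\<in>I - {i}. f j g))" for g
    unfolding sum_distrib_left
  proof (intro sum.cong refl)
    fix i assume "i \<in> I"
    then have "insert k I - {i} = insert k (I - {i})" using insert by auto
    then show "f' i g * (\<Prod>j\<in>insert k I - {i}. f j g) = f k g * (f' i g * (\<Prod>j\<in>I - {i}. f j g))"
      using insert by simp
  qed
  ultimately show ?case
    using insert by simp
qed


section \<open>The Casimir operator on traces of words in one variable\<close>

lemma rotate_eq_Cons: "i < length w \<Longrightarrow> rotate i w = w ! i # drop (Suc i) w @ take i w"
  by (simp add: rotate_drop_take Cons_nth_drop_Suc[symmetric])

lemma rotate_offset: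
  assumes "i < length w" "j < length w" "i \<noteq> j"
  defines "k \<equiv> (j + length w - i) mod length w"
  shows "0 < k" "k < length w" "rotate i w ! k = w ! j" "rotate i w ! 0 = w ! i"
proof -
  have kk: "k = (if j < i then j + length w - i else j - i)"
    using assms by (auto simp: k_def le_mod_geq intro!: mod_less)
  then show "0 < k" and kw: "k < length w" using assms by auto
  have "i + k = (if j < i then j + length w else j)"
    unfolding kk using assms(1-3) by auto
  then have "(i + k) mod length w = j" using assms by simp
  with kw show "rotate i w ! k = w ! j" by (simp add: nth_rotate)
  show "rotate i w ! 0 = w ! i" using assms(1) by (subst nth_rotate) auto
qed

lemma hd_rotate: "i < length w \<Longrightarrow> hd (rotate i w) = w ! i"
  by (simp add: rotate_eq_Cons)

text \<open>A word is a list of letters. A letter in \<open>P\<close> stands for the variable \<open>g\<close>, a letter in \<open>N\<close> for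
  its inverse, any other letter for a constant matrix. Replacing \<open>g\<close> by \<open>mexp (tW) g\<close> inserts
  \<open>W\<close> in front of a letter of \<open>P\<close> and \<open>- W\<close> behind a letter of \<open>N\<close>; \<open>slot\<close> is the place of this
  insertion and \<open>sign\<close> its sign.\<close>

definition word_trace :: "('a \<Rightarrow> complex^'d^'d) \<Rightarrow> 'a list \<Rightarrow> complex" where
  "word_trace V w = trace (mprod (map V w))"

lemma word_trace_commute: "word_trace V (u @ v) = word_trace V (v @ u)"
  unfolding word_trace_def map_append mprod_append by (rule trace_mul_sym)

lemma word_trace_rotate: "word_trace V (rotate k w) = word_trace V w"
  unfolding rotate_drop_take by (subst word_trace_commute) simp

lemma word_trace_Nil [simp]: "word_trace (V :: 'a \<Rightarrow> complex^'d^'d) [] = of_nat CARD('d)"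
  by (simp add: word_trace_def trace_I)

locale words_in_one_variable =
  fixes P N :: "'a set" and \<phi> :: "'a \<Rightarrow> complex^'d^'d"
  assumes disjoint: "P \<inter> N = {}"
begin

definition val :: "complex^'d^'d \<Rightarrow> 'a \<Rightarrow> complex^'d^'d" where
  "val g a = (if a \<in> P then g else if a \<in> N then cadj g else \<phi> a)"

definition sign :: "'a \<Rightarrow> real" where
  "sign a = (if a \<in> P then 1 else if a \<in> N then -1 else 0)"

definition slot :: "'a list \<Rightarrow> nat \<Rightarrow> nat" where
  "slot w i = (if w ! i \<in> N then Suc i else i)"

text \<open>The cyclic word read from the slot of \<open>i\<close> on: since the trace is cyclic, an insertion of \<open>W\<close> into
  the slot gives \<open>Tr (W X)\<close> with \<open>X\<close> the product of the opened word.\<close>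

definition opened :: "'a list \<Rightarrow> nat \<Rightarrow> 'a list" where
  "opened w i = drop (slot w i) w @ take (slot w i) w"

abbreviation wt :: "complex^'d^'d \<Rightarrow> 'a list \<Rightarrow> complex" where
  "wt g \<equiv> word_trace (val g)"

abbreviation wprod :: "complex^'d^'d \<Rightarrow> 'a list \<Rightarrow> complex^'d^'d" where
  "wprod g w \<equiv> mprod (map (val g) w)"

lemma val_has_vector_derivative:
  "((\<lambda>t. val (mexp (t *\<^sub>R W) ** g) a) has_vector_derivative
     (if a \<in> P then W ** g else if a \<in> N then cadj g ** cadj W else 0)) (at 0)"
proof -
  have E: "((\<lambda>t. mexp (t *\<^sub>R W) ** g) has_vector_derivative W ** g) (at 0)"
    using bounded_linear.has_vector_derivative[OF matrix_mult.bounded_linear_left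
        mexp_has_vector_derivative[of W 0]]
    by (simp add: matrix_mul_rid)
  have "((\<lambda>t. cadj (mexp (t *\<^sub>R W) ** g)) has_vector_derivative cadj (W ** g)) (at 0)"
    by (rule bounded_linear.has_vector_derivative[OF bounded_linear_cadj E])
  with E show ?thesis by (auto simp: val_def cadj_mult)
qed

text \<open>The Leibniz rule, by induction on the word. The places \<open>i\<close> of constant letters have sign \<open>0\<close>.\<close>

lemma wprod_has_vector_derivative:
  assumes W: "antihermitian W"
  shows "((\<lambda>t. wprod (mexp (t *\<^sub>R W) ** g) w) has_vector_derivative
     (\<Sum>i<length w. sign (w ! i) *\<^sub>R
        (wprod g (take (slot w i) w) ** W ** wprod g (drop (slot w i) w)))) (at 0)"
proof (induction w)
  case Nil
  then show ?case by simp
next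
  case (Cons a w)
  have val0: "val (mexp (0 *\<^sub>R W) ** g) = val g" by (simp add: matrix_mul_lid)
  let ?D = "if a \<in> P then W ** g else if a \<in> N then cadj g ** cadj W else 0"
  have "((\<lambda>t. wprod (mexp (t *\<^sub>R W) ** g) (a # w)) has_vector_derivative
      val g a ** (\<Sum>i<length w. sign (w ! i) *\<^sub>R
        (wprod g (take (slot w i) w) ** W ** wprod g (drop (slot w i) w)))
      + ?D ** wprod g w) (at 0)"
    using matrix_mult.has_vector_derivative[OF val_has_vector_derivative[of W g a] Cons.IH]
    unfolding val0 by simp
  moreover have "?D ** wprod g w = sign a *\<^sub>R
      (wprod g (take (slot (a # w) 0) (a # w)) ** W ** wprod g (drop (slot (a # w) 0) (a # w)))"
    using W disjoint
    by (auto simp: sign_def slot_def val_def antihermitian_def matrix_mul_lid matrix_mul_rid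
        matrix_mul_assoc matrix_mult.minus_left matrix_mult.minus_right matrix_mult.zero_left)
  moreover have "slot (a # w) (Suc i) = Suc (slot w i)" for i
    by (simp add: slot_def)
  ultimately show ?case
    by (simp add: sum.lessThan_Suc_shift matrix_mult.sum_right matrix_mult.scaleR_right
        matrix_mul_assoc add.commute del: sum.lessThan_Suc)
qed

text \<open>Leaving a free factor \<open>A\<close> in front makes the rule usable twice: with \<open>A = 1\<close> for the first
  derivative of a trace, and with \<open>A\<close> the first insertion for the second.\<close>

lemma has_lie_deriv_wprod:
  assumes W: "antihermitian W"
  shows "has_lie_deriv W (\<lambda>g. trace (A ** wprod g w)) (\<lambda>g. \<Sum>i<length w. sign (w ! i) *\<^sub>R
     trace (A ** wprod g (take (slot w i) w) ** W ** wprod g (drop (slot w i) w)))"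
  unfolding has_lie_deriv_def
proof
  fix g :: "complex^'d^'d"
  have "((\<lambda>t. trace (A ** wprod (mexp (t *\<^sub>R W) ** g) w)) has_vector_derivative
      trace (A ** (\<Sum>i<length w. sign (w ! i) *\<^sub>R
        (wprod g (take (slot w i) w) ** W ** wprod g (drop (slot w i) w))))) (at 0)"
    by (intro trace_has_vector_derivative wprod_has_vector_derivative[OF W]
        bounded_linear.has_vector_derivative[OF matrix_mult.bounded_linear_right])
  also have "trace (A ** (\<Sum>i<length w. sign (w ! i) *\<^sub>R
        (wprod g (take (slot w i) w) ** W ** wprod g (drop (slot w i) w))))
      = (\<Sum>i<length w. sign (w ! i) *\<^sub>R
          trace (A ** wprod g (take (slot w i) w) ** W ** wprod g (drop (slot w i) w)))"
    by (simp add: matrix_mult.sum_right matrix_mult.scaleR_right matrix_mul_assoc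
        linear_sum[OF bounded_linear.linear[OF bounded_linear_trace]]
        linear_cmul[OF bounded_linear.linear[OF bounded_linear_trace]])
  finally show "((\<lambda>t. trace (A ** wprod (mexp (t *\<^sub>R W) ** g) w)) has_vector_derivative
      (\<Sum>i<length w. sign (w ! i) *\<^sub>R
        trace (A ** wprod g (take (slot w i) w) ** W ** wprod g (drop (slot w i) w)))) (at 0)" .
qed

text \<open>The derivatives are kept as explicit sums over letters, because the sum over the basis has to be
  taken inside them.\<close>

definition d1 :: "complex^'d^'d \<Rightarrow> 'a list \<Rightarrow> complex^'d^'d \<Rightarrow> complex" where
  "d1 W w g = (\<Sum>i<length w. sign (w ! i) *\<^sub>R trace (W ** wprod g (opened w i)))"

definition d2 :: "complex^'d^'d \<Rightarrow> 'a list \<Rightarrow> complex^'d^'d \<Rightarrow> complex" where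
  "d2 W w g = (\<Sum>i<length w. sign (w ! i) *\<^sub>R (\<Sum>j<length w. sign (opened w i ! j) *\<^sub>R
     trace (W ** wprod g (take (slot (opened w i) j) (opened w i)) ** W **
       wprod g (drop (slot (opened w i) j) (opened w i)))))"

lemma length_opened [simp]: "i < length w \<Longrightarrow> length (opened w i) = length w"
  by (simp add: opened_def slot_def)

lemma has_lie_deriv_wt:
  assumes W: "antihermitian W"
  shows "has_lie_deriv W (\<lambda>g. wt g w) (d1 W w)"
proof -
  have "trace (X ** W ** Y) = trace (W ** (Y ** X))" for X Y :: "complex^'d^'d"
    using trace_mul_sym[of X "W ** Y"] by (simp add: matrix_mul_assoc)
  then have "d1 W w = (\<lambda>g. \<Sum>i<length w. sign (w ! i) *\<^sub>R
     trace (mat 1 ** wprod g (take (slot w i) w) ** W ** wprod g (drop (slot w i) w)))"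
    by (simp add: fun_eq_iff d1_def opened_def mprod_append matrix_mul_lid)
  then show ?thesis
    using has_lie_deriv_wprod[OF W, of "mat 1" w] by (simp add: word_trace_def matrix_mul_lid)
qed

lemma has_lie_deriv_d1:
  assumes W: "antihermitian W"
  shows "has_lie_deriv W (d1 W w) (d2 W w)"
proof -
  have "has_lie_deriv W (\<lambda>g. d1 W w g) (\<lambda>g. d2 W w g)"
    unfolding d1_def d2_def
  proof (intro has_lie_deriv_sum has_lie_deriv_scaleR)
    fix i assume "i \<in> {..<length w}"
    then have "length w = length (opened w i)" by simp
    then show "has_lie_deriv W (\<lambda>g. trace (W ** wprod g (opened w i)))
        (\<lambda>g. \<Sum>j<length w. sign (opened w i ! j) *\<^sub>R
          trace (W ** wprod g (take (slot (opened w i) j) (opened w i)) ** W **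
            wprod g (drop (slot (opened w i) j) (opened w i))))"
      using has_lie_deriv_wprod[OF W, of W "opened w i"] by simp
  qed
  then show ?thesis by simp
qed

definition words_trace :: "'a list list \<Rightarrow> complex^'d^'d \<Rightarrow> complex" where
  "words_trace ws g = (\<Prod>a<length ws. wt g (ws ! a))"

definition words_d1 :: "complex^'d^'d \<Rightarrow> 'a list list \<Rightarrow> complex^'d^'d \<Rightarrow> complex" where
  "words_d1 W ws g = (\<Sum>a<length ws. d1 W (ws ! a) g * (\<Prod>c\<in>{..<length ws} - {a}. wt g (ws ! c)))"

definition words_d2 :: "complex^'d^'d \<Rightarrow> 'a list list \<Rightarrow> complex^'d^'d \<Rightarrow> complex" where
  "words_d2 W ws g = (\<Sum>a<length ws. d2 W (ws ! a) g * (\<Prod>c\<in>{..<length ws} - {a}. wt g (ws ! c))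
     + d1 W (ws ! a) g * (\<Sum>b\<in>{..<length ws} - {a}. d1 W (ws ! b) g *
         (\<Prod>c\<in>{..<length ws} - {a} - {b}. wt g (ws ! c))))"

lemma has_lie_deriv_words_trace:
  assumes W: "antihermitian W"
  shows "has_lie_deriv W (words_trace ws) (words_d1 W ws)"
proof -
  have "has_lie_deriv W (\<lambda>g. words_trace ws g) (\<lambda>g. words_d1 W ws g)"
    unfolding words_trace_def words_d1_def
    by (intro has_lie_deriv_prod has_lie_deriv_wt W) simp
  then show ?thesis by simp
qed

lemma has_lie_deriv_words_d1:
  assumes W: "antihermitian W"
  shows "has_lie_deriv W (words_d1 W ws) (words_d2 W ws)"
proof -
  have "has_lie_deriv W (\<lambda>g. words_d1 W ws g) (\<lambda>g. words_d2 W ws g)"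
    unfolding words_d1_def words_d2_def
    by (intro has_lie_deriv_sum has_lie_deriv_mult has_lie_deriv_d1 has_lie_deriv_prod
        has_lie_deriv_wt W) simp
  then show ?thesis by simp
qed

text \<open>Both insertions in the same word: it is cut in two.\<close>

lemma sum_d2:
  assumes B: "orthonormal_basis_antiherm B"
  shows "(\<Sum>W\<in>B. d2 W w g) = - (\<Sum>i<length w. sign (w ! i) *\<^sub>R (\<Sum>j<length w.
     sign (opened w i ! j) *\<^sub>R (wt g (take (slot (opened w i) j) (opened w i)) *
       wt g (drop (slot (opened w i) j) (opened w i)))))"
  unfolding d2_def
  by (subst sum.swap)
     (simp only: sum.swap[of _ _ B] casimir_cut[OF B] word_trace_def sum_negf
       scaleR_minus_right flip: scaleR_right.sum)

text \<open>Insertions in two different words: they are joined.\<close>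

lemma sum_d1_d1:
  assumes B: "orthonormal_basis_antiherm B"
  shows "(\<Sum>W\<in>B. d1 W w g * d1 W w' g) = - (\<Sum>i<length w. \<Sum>j<length w'.
     (sign (w ! i) * sign (w' ! j)) *\<^sub>R wt g (opened w i @ opened w' j))"
proof -
  have "(\<Sum>W\<in>B. d1 W w g * d1 W w' g) = (\<Sum>W\<in>B. \<Sum>i<length w. \<Sum>j<length w'.
     (sign (w ! i) * sign (w' ! j)) *\<^sub>R
       (trace (W ** wprod g (opened w i)) * trace (W ** wprod g (opened w' j))))"
    unfolding d1_def sum_product by (simp add: mult.commute)
  also have "\<dots> = (\<Sum>i<length w. \<Sum>j<length w'. \<Sum>W\<in>B. (sign (w ! i) * sign (w' ! j)) *\<^sub>R
       (trace (W ** wprod g (opened w i)) * trace (W ** wprod g (opened w' j))))"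
    by (simp only: sum.swap[of _ _ B])
  also have "\<dots> = (\<Sum>i<length w. \<Sum>j<length w'. - ((sign (w ! i) * sign (w' ! j)) *\<^sub>R
       wt g (opened w i @ opened w' j)))"
    by (simp only: casimir_merge[OF B] word_trace_def map_append mprod_append
       scaleR_minus_right flip: scaleR_right.sum)
  finally show ?thesis by (simp add: sum_negf)
qed

lemma sign_eq_0_iff: "sign a = 0 \<longleftrightarrow> a \<notin> P \<union> N"
  by (simp add: sign_def)

definition same_kind :: "'a \<Rightarrow> 'a \<Rightarrow> bool" where
  "same_kind a b \<longleftrightarrow> (a \<in> P \<longleftrightarrow> b \<in> P)"

text \<open>The outcome of cutting one word at the places \<open>0\<close> and \<open>k\<close>, and of merging two words at their
  first letters. Letters of opposite kinds are erased, as are the crossings in a negative split or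
  merge.\<close>

definition split_term :: "complex^'d^'d \<Rightarrow> 'a list \<Rightarrow> nat \<Rightarrow> complex" where
  "split_term g w k =
     (if same_kind (w ! 0) (w ! k) then wt g (take k w) * wt g (drop k w)
      else wt g (take (k - 1) (tl w)) * wt g (drop (k + 1) w))"

definition merge_term :: "complex^'d^'d \<Rightarrow> 'a list \<Rightarrow> 'a list \<Rightarrow> complex" where
  "merge_term g w w' =
     (if same_kind (hd w) (hd w') then wt g (w @ w') else wt g (tl w @ tl w'))"

text \<open>On unitary matrices a letter of \<open>P\<close> and a letter of \<open>N\<close> are inverse to each other.\<close>

lemma wt_cancel:
  assumes "g \<in> unitary_group" "a \<in> P \<and> b \<in> N \<or> a \<in> N \<and> b \<in> P"
  shows "wt g (u @ a # b # v) = wt g (u @ v)"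
proof -
  have "val g a ** val g b = mat 1"
    using assms disjoint by (auto simp: val_def unitary_cancel)
  then have "mprod (map (val g) (u @ a # b # v)) = mprod (map (val g) (u @ v))"
    by (simp add: mprod_append matrix_mul_assoc[of "val g a"] matrix_mul_lid)
  then show ?thesis by (simp only: word_trace_def)
qed

lemma wt_cancel_ends:
  assumes "g \<in> unitary_group" "a \<in> P \<and> b \<in> N \<or> a \<in> N \<and> b \<in> P"
  shows "wt g (a # u @ [b]) = wt g u"
  using wt_cancel[OF assms(1), of b a u "[]"] assms(2) word_trace_commute[of "val g" "[a]" "u @ [b]"]
  by auto

lemma wt_replace: "val g a = val g b \<Longrightarrow> wt g (u @ a # v) = wt g (u @ b # v)"
  by (simp add: word_trace_def)

lemma opened_eq:
  assumes "i < length w" "rotate i w = a # r"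
  shows "opened w i = (if a \<in> N then r @ [a] else a # r)"
proof -
  have "drop i w @ take i w = a # r"
    using assms by (simp add: rotate_drop_take)
  moreover have "drop i w = w ! i # drop (Suc i) w" "take (Suc i) w = take i w @ [w ! i]"
    using assms by (simp_all add: Cons_nth_drop_Suc take_Suc_conv_app_nth)
  ultimately show ?thesis by (auto simp: opened_def slot_def)
qed

text \<open>The second insertion, once the word has been opened at the first. Returning to the same letter
  cuts off the empty word. For any other letter the slots lie on one or the other side of the two
  letters according to their kinds; cyclicity of the trace, equality of the values of letters of the
  same kind and cancellation of opposite ones bring all cases to the form of \<open>split_term\<close>.\<close>

lemma sum_opened:
  assumes g: "g \<in> unitary_group" and i: "i < length w" and active: "w ! i \<in> P \<union> N"
  shows "(\<Sum>j<length w. sign (opened w i ! j) *\<^sub>R (wt g (take (slot (opened w i) j) (opened w i)) *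
       wt g (drop (slot (opened w i) j) (opened w i))))
    = sign (w ! i) *\<^sub>R (of_nat CARD('d) * wt g w)
      + (\<Sum>k\<in>{1..<length w}. sign (rotate i w ! k) *\<^sub>R split_term g (rotate i w) k)"
proof -
  define a where "a = w ! i"
  obtain r where r: "rotate i w = a # r"
    using rotate_eq_Cons i by (auto simp: a_def)
  have w: "wt g w = wt g (a # r)"
    using word_trace_rotate[of "val g" i w] r by simp
  have len: "length w = Suc (length r)"
    using arg_cong[OF r, of length] by simp
  have shift: "(\<Sum>k\<in>{1..<length w}. f k) = (\<Sum>j<length r. f (Suc j))" for f :: "nat \<Rightarrow> complex"
    by (simp add: len sum.shift_bounds_Suc_ivl atLeast0LessThan del: sum.op_ivl_Suc)
  let ?T = "\<lambda>u j. sign (u ! j) *\<^sub>R (wt g (take (slot u j) u) * wt g (drop (slot u j) u))"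
  have rhs: "(\<Sum>k\<in>{1..<length w}. sign (rotate i w ! k) *\<^sub>R split_term g (rotate i w) k)
      = (\<Sum>j<length r. sign (r ! j) *\<^sub>R split_term g (a # r) (Suc j))"
    unfolding shift r by simp
  show ?thesis
  proof (cases "a \<in> P")
    case True
    then have aN: "a \<notin> N" using disjoint by auto
    have opened: "opened w i = a # r" using opened_eq[OF i r] aN by simp
    have eq: "?T (a # r) (Suc j) = sign (r ! j) *\<^sub>R split_term g (a # r) (Suc j)"
      if j: "j < length r" for j
    proof (cases "r ! j \<in> N")
      case bN: True
      then have "r ! j \<notin> P" using disjoint by auto
      moreover have "take (Suc j) r = take j r @ [r ! j]"
        using j by (simp add: take_Suc_conv_app_nth)
      ultimately show ?thesis
        using True bN wt_cancel_ends[OF g, of a "r ! j" "take j r"]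
        by (simp add: split_term_def same_kind_def slot_def)
    next
      case False
      then show ?thesis
        using True by (simp add: split_term_def same_kind_def slot_def sign_def)
    qed
    have zero: "?T (a # r) 0 = sign a *\<^sub>R (of_nat CARD('d) * wt g w)"
      using aN by (simp add: slot_def w)
    have "(\<Sum>j<length w. ?T (a # r) j) = ?T (a # r) 0 + (\<Sum>j<length r. ?T (a # r) (Suc j))"
      unfolding len by (rule sum.lessThan_Suc_shift)
    also have "(\<Sum>j<length r. ?T (a # r) (Suc j))
        = (\<Sum>j<length r. sign (r ! j) *\<^sub>R split_term g (a # r) (Suc j))"
      by (intro sum.cong refl eq) simp
    finally show ?thesis
      unfolding rhs opened zero a_def[symmetric] .
  next
    case False
    then have aN: "a \<in> N" using active by (simp add: a_def)
    have opened: "opened w i = r @ [a]" using opened_eq[OF i r] aN by simp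
    have eq: "?T (r @ [a]) j = sign (r ! j) *\<^sub>R split_term g (a # r) (Suc j)"
      if j: "j < length r" for j
    proof -
      have take: "take (Suc j) r = take j r @ [r ! j]" and drop: "drop j r = r ! j # drop (Suc j) r"
        using j by (simp_all add: take_Suc_conv_app_nth Cons_nth_drop_Suc)
      consider "r ! j \<in> P" | "r ! j \<in> N" "r ! j \<notin> P" | "r ! j \<notin> P \<union> N" by blast
      then show ?thesis
      proof cases
        case 1
        then have "r ! j \<notin> N" using disjoint by auto
        then show ?thesis
          using j 1 False aN wt_cancel_ends[OF g, of "r ! j" a "drop (Suc j) r"]
          by (simp add: split_term_def same_kind_def slot_def nth_append drop)
      next
        case 2
        have "wt g (take j r @ [r ! j]) = wt g (a # take j r)"
          using wt_replace[of g a "r ! j" "take j r" "[]"] aN False 2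
            word_trace_commute[of "val g" "[a]" "take j r"] by (simp add: val_def)
        moreover have "wt g (drop (Suc j) r @ [a]) = wt g (r ! j # drop (Suc j) r)"
          using wt_replace[of g a "r ! j" "drop (Suc j) r" "[]"] aN False 2
            word_trace_commute[of "val g" "[r ! j]" "drop (Suc j) r"] by (simp add: val_def)
        ultimately show ?thesis
          using j 2 False by (simp add: split_term_def same_kind_def slot_def nth_append take drop)
      next
        case 3
        then show ?thesis using j by (simp add: sign_def nth_append)
      qed
    qed
    have zero: "?T (r @ [a]) (length r) = sign a *\<^sub>R (of_nat CARD('d) * wt g w)"
      using aN word_trace_commute[of "val g" r "[a]"] by (simp add: slot_def w)
    have "(\<Sum>j<length w. ?T (r @ [a]) j) = (\<Sum>j<length r. ?T (r @ [a]) j) + ?T (r @ [a]) (length r)"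
      unfolding len by (rule sum.lessThan_Suc)
    also have "(\<Sum>j<length r. ?T (r @ [a]) j)
        = (\<Sum>j<length r. sign (r ! j) *\<^sub>R split_term g (a # r) (Suc j))"
      by (intro sum.cong refl eq) simp
    finally show ?thesis
      unfolding rhs opened zero a_def[symmetric] by (simp only: add.commute)
  qed
qed

text \<open>The analogue for two words, with the same case distinction on the kinds of the letters.\<close>

lemma wt_opened_append:
  assumes g: "g \<in> unitary_group" and i: "i < length w" "w ! i \<in> P \<union> N"
    and j: "j < length w'" "w' ! j \<in> P \<union> N"
  shows "wt g (opened w i @ opened w' j) = merge_term g (rotate i w) (rotate j w')"
proof -
  define a b where "a = w ! i" and "b = w' ! j"
  obtain r where r: "rotate i w = a # r"
    using rotate_eq_Cons i by (auto simp: a_def)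
  obtain s where s: "rotate j w' = b # s"
    using rotate_eq_Cons j by (auto simp: b_def)
  have ab: "a \<in> P \<union> N" "b \<in> P \<union> N" using i j by (simp_all add: a_def b_def)
  consider "a \<in> P" "b \<in> P" "a \<notin> N" "b \<notin> N" | "a \<in> N" "b \<in> N" "a \<notin> P" "b \<notin> P"
    | "a \<in> P" "b \<in> N" "a \<notin> N" "b \<notin> P" | "a \<in> N" "b \<in> P" "a \<notin> P" "b \<notin> N"
    using ab disjoint by blast
  then show ?thesis
  proof cases
    case 2
    have v: "val g a = val g b" using 2 by (simp add: val_def)
    have "wt g (r @ a # s @ [b]) = wt g (r @ b # s @ [a])"
      using wt_replace[OF v, of r "s @ [b]"] wt_replace[OF v[symmetric], of "r @ b # s" "[]"] by simp
    also have "\<dots> = wt g (a # r @ b # s)"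
      using word_trace_commute[of "val g" "r @ b # s" "[a]"] by simp
    finally show ?thesis
      using 2 opened_eq[OF i(1) r] opened_eq[OF j(1) s] by (simp add: r s merge_term_def same_kind_def)
  next
    case 3
    then show ?thesis
      using wt_cancel_ends[OF g, of a b "r @ s"] opened_eq[OF i(1) r] opened_eq[OF j(1) s]
      by (simp add: r s merge_term_def same_kind_def)
  next
    case 4
    then show ?thesis
      using wt_cancel[OF g, of a b r s] opened_eq[OF i(1) r] opened_eq[OF j(1) s]
      by (simp add: r s merge_term_def same_kind_def)
  qed (use opened_eq[OF i(1) r] opened_eq[OF j(1) s] in
        \<open>simp add: r s merge_term_def same_kind_def\<close>)
qed

text \<open>The position of the second letter is counted from the first one, cyclically.\<close>

lemma sum_rotate:
  fixes f :: "'a \<Rightarrow> nat \<Rightarrow> complex"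
  assumes "i < length w"
  shows "(\<Sum>k\<in>{1..<length w}. f (rotate i w ! k) k)
    = (\<Sum>j\<in>{..<length w} - {i}. f (w ! j) ((j + length w - i) mod length w))"
proof (rule sum.reindex_bij_witness[where j = "\<lambda>k. (i + k) mod length w"
      and i = "\<lambda>j. (j + length w - i) mod length w"])
  fix k assume k: "k \<in> {1..<length w}"
  have mod: "(i + k) mod length w = (if i + k < length w then i + k else i + k - length w)"
    using k assms by (auto simp: le_mod_geq intro!: mod_less)
  have "(i + k) mod length w + length w - i = (if i + k < length w then k + length w else k)"
    using k assms by (simp add: mod)
  then show inv: "((i + k) mod length w + length w - i) mod length w = k"
    using k by simp
  then show "f (w ! ((i + k) mod length w)) (((i + k) mod length w + length w - i) mod length w)
      = f (rotate i w ! k) k"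
    using k by (simp add: nth_rotate)
  show "(i + k) mod length w \<in> {..<length w} - {i}"
    using k assms by (auto simp: mod)
next
  fix j assume j: "j \<in> {..<length w} - {i}"
  have mod: "(j + length w - i) mod length w = (if j < i then j + length w - i else j - i)"
    using j assms by (auto simp: le_mod_geq intro!: mod_less)
  have "i + (j + length w - i) mod length w = (if j < i then j + length w else j)"
    using j assms by (simp add: mod)
  then show "(i + (j + length w - i) mod length w) mod length w = j"
    using j by simp
  show "(j + length w - i) mod length w \<in> {1..<length w}"
    using j assms by (auto simp: mod)
qed

definition active :: "'a list list \<Rightarrow> (nat \<times> nat) set" where
  "active ws = {(a, i). a < length ws \<and> i < length (ws ! a) \<and> ws ! a ! i \<in> P \<union> N}"

definition sign_at :: "'a list list \<Rightarrow> nat \<times> nat \<Rightarrow> real" where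
  "sign_at ws = (\<lambda>(a, i). sign (ws ! a ! i))"

text \<open>The value of a product of word traces after a split or merge at two places; a place is a pair
  of the number of a word and a position in it.\<close>

definition joint :: "complex^'d^'d \<Rightarrow> 'a list list \<Rightarrow> nat \<times> nat \<Rightarrow> nat \<times> nat \<Rightarrow> complex" where
  "joint g ws = (\<lambda>(a, i) (b, j).
     if a = b then
       split_term g (rotate i (ws ! a)) ((j + length (ws ! a) - i) mod length (ws ! a)) *
         (\<Prod>c\<in>{..<length ws} - {a}. wt g (ws ! c))
     else
       merge_term g (rotate i (ws ! a)) (rotate j (ws ! b)) *
         (\<Prod>c\<in>{..<length ws} - {a} - {b}. wt g (ws ! c)))"

text \<open>The part of the second derivative with a given first insertion: the same place again, the other
  places of the same word, and the places of the other words.\<close>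

lemma sum_words_d2_at:
  fixes g :: "complex^'d^'d"
  assumes g: "g \<in> unitary_group" and s: "(a, i) \<in> active ws"
  defines "n \<equiv> length ws" and "rest \<equiv> \<lambda>C. \<Prod>c\<in>C. wt g (ws ! c)"
  shows "sign (ws ! a ! i) *\<^sub>R (\<Sum>j<length (ws ! a). sign (opened (ws ! a) i ! j) *\<^sub>R
        (wt g (take (slot (opened (ws ! a) i) j) (opened (ws ! a) i)) *
         wt g (drop (slot (opened (ws ! a) i) j) (opened (ws ! a) i)))) * rest ({..<n} - {a})
      + (\<Sum>b\<in>{..<n} - {a}. \<Sum>j<length (ws ! b). (sign (ws ! a ! i) * sign (ws ! b ! j)) *\<^sub>R
          wt g (opened (ws ! a) i @ opened (ws ! b) j) * rest ({..<n} - {a} - {b}))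
    = of_nat CARD('d) * words_trace ws g
      + (\<Sum>t\<in>active ws - {(a, i)}. (sign_at ws (a, i) * sign_at ws t) *\<^sub>R joint g ws (a, i) t)"
    (is "?split + ?merge = _")
proof -
  define w where "w = ws ! a"
  have a: "a < n" and i: "i < length w" and act: "w ! i \<in> P \<union> N"
    using s by (auto simp: active_def n_def w_def)
  have sq: "sign (w ! i) * sign (w ! i) = 1" using act by (auto simp: sign_def)
  let ?J = "\<lambda>t. (sign_at ws (a, i) * sign_at ws t) *\<^sub>R joint g ws (a, i) t"
  have "?split = (sign (w ! i) *\<^sub>R (sign (w ! i) *\<^sub>R (of_nat CARD('d) * wt g w)
      + (\<Sum>j\<in>{..<length w} - {i}. sign (w ! j) *\<^sub>R
          split_term g (rotate i w) ((j + length w - i) mod length w)))) * rest ({..<n} - {a})"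
    unfolding w_def[symmetric] sum_opened[OF g i act]
    by (subst sum_rotate[OF i, of "\<lambda>c k. sign c *\<^sub>R split_term g (rotate i w) k"]) (rule refl)
  also have "\<dots> = of_nat CARD('d) * (wt g w * rest ({..<n} - {a})) + (\<Sum>j\<in>{..<length w} - {i}. ?J (a, j))"
    using sq by (simp add: scaleR_add_right distrib_right scaleR_right.sum sum_distrib_right sign_at_def
        joint_def w_def n_def rest_def mult.assoc)
  also have "wt g w * rest ({..<n} - {a}) = words_trace ws g"
    using a by (simp add: rest_def w_def words_trace_def n_def prod.remove[of "{..<length ws}" a])
  also have "(\<Sum>j\<in>{..<length w} - {i}. ?J (a, j)) = (\<Sum>t\<in>{a} \<times> ({..<length w} - {i}). ?J t)"
    by (rule sum.reindex_bij_witness[of _ snd "Pair a"]) auto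
  finally have split: "?split = of_nat CARD('d) * words_trace ws g
      + (\<Sum>t\<in>{a} \<times> ({..<length w} - {i}). ?J t)" .
  have "?merge = (\<Sum>b\<in>{..<n} - {a}. \<Sum>j<length (ws ! b). ?J (b, j))"
  proof (intro sum.cong refl)
    fix b j assume b: "b \<in> {..<n} - {a}" and j: "j \<in> {..<length (ws ! b)}"
    show "(sign (ws ! a ! i) * sign (ws ! b ! j)) *\<^sub>R
          wt g (opened (ws ! a) i @ opened (ws ! b) j) * rest ({..<n} - {a} - {b}) = ?J (b, j)"
    proof (cases "ws ! b ! j \<in> P \<union> N")
      case True
      then show ?thesis
        using b j i act wt_opened_append[OF g i act, of j "ws ! b"]
        by (auto simp: sign_at_def joint_def n_def rest_def w_def)
    next
      case False
      then show ?thesis by (simp add: sign_def sign_at_def)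
    qed
  qed
  also have "\<dots> = (\<Sum>t\<in>Sigma ({..<n} - {a}) (\<lambda>b. {..<length (ws ! b)}). ?J t)"
    by (simp add: sum.Sigma)
  finally have merge: "?merge = (\<Sum>t\<in>Sigma ({..<n} - {a}) (\<lambda>b. {..<length (ws ! b)}). ?J t)" .
  have "(\<Sum>t\<in>{a} \<times> ({..<length w} - {i}). ?J t)
      + (\<Sum>t\<in>Sigma ({..<n} - {a}) (\<lambda>b. {..<length (ws ! b)}). ?J t)
      = (\<Sum>t\<in>{a} \<times> ({..<length w} - {i}) \<union> Sigma ({..<n} - {a}) (\<lambda>b. {..<length (ws ! b)}). ?J t)"
    by (rule sum.union_disjoint[symmetric]) auto
  also have "\<dots> = (\<Sum>t\<in>active ws - {(a, i)}. ?J t)"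
  proof (rule sum.mono_neutral_right)
    show "active ws - {(a, i)}
        \<subseteq> {a} \<times> ({..<length w} - {i}) \<union> Sigma ({..<n} - {a}) (\<lambda>b. {..<length (ws ! b)})"
      by (auto simp: active_def w_def n_def)
    show "\<forall>t\<in>{a} \<times> ({..<length w} - {i}) \<union> Sigma ({..<n} - {a}) (\<lambda>b. {..<length (ws ! b)})
        - (active ws - {(a, i)}). ?J t = 0"
      using a by (auto simp: active_def w_def n_def sign_at_def sign_eq_0_iff)
  qed auto
  finally show ?thesis
    by (simp only: split merge add.assoc)
qed

text \<open>The Casimir operator contracts the insertions of all ordered pairs of occurrences of the
  variable. A pair made of twice the same occurrence contributes the factor \<open>d\<close>, the trace of
  the empty word; all others split or merge words.\<close>

lemma sum_words_d2:
  fixes g :: "complex^'d^'d"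
  assumes B: "orthonormal_basis_antiherm B" and g: "g \<in> unitary_group"
  shows "(\<Sum>W\<in>B. words_d2 W ws g) = - (of_nat CARD('d) * of_nat (card (active ws)) * words_trace ws g
     + (\<Sum>s\<in>active ws. \<Sum>t\<in>active ws - {s}. (sign_at ws s * sign_at ws t) *\<^sub>R joint g ws s t))"
proof -
  define n where "n = length ws"
  define rest where "rest = (\<lambda>C. \<Prod>c\<in>C. wt g (ws ! c))"
  define A where "A = (\<lambda>a i. sign (ws ! a ! i) *\<^sub>R (\<Sum>j<length (ws ! a). sign (opened (ws ! a) i ! j) *\<^sub>R
        (wt g (take (slot (opened (ws ! a) i) j) (opened (ws ! a) i)) *
         wt g (drop (slot (opened (ws ! a) i) j) (opened (ws ! a) i)))) * rest ({..<n} - {a}))"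
  define M where "M = (\<lambda>a i. \<Sum>b\<in>{..<n} - {a}. \<Sum>j<length (ws ! b). (sign (ws ! a ! i) * sign (ws ! b ! j)) *\<^sub>R
          wt g (opened (ws ! a) i @ opened (ws ! b) j) * rest ({..<n} - {a} - {b}))"
  have "(\<Sum>W\<in>B. words_d2 W ws g) = (\<Sum>a<n. (\<Sum>W\<in>B. d2 W (ws ! a) g) * rest ({..<n} - {a})
      + (\<Sum>b\<in>{..<n} - {a}. (\<Sum>W\<in>B. d1 W (ws ! a) g * d1 W (ws ! b) g) * rest ({..<n} - {a} - {b})))"
    unfolding words_d2_def n_def[symmetric] rest_def[symmetric]
    by (simp add: sum.swap[of _ _ B] sum.distrib sum_distrib_left sum_distrib_right mult.assoc)
  also have "\<dots> = - (\<Sum>a<n. \<Sum>i<length (ws ! a). A a i + M a i)"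
  proof -
    have "(\<Sum>b\<in>{..<n} - {a}. (\<Sum>W\<in>B. d1 W (ws ! a) g * d1 W (ws ! b) g) * rest ({..<n} - {a} - {b}))
        = - (\<Sum>i<length (ws ! a). M a i)" for a
      unfolding M_def sum_d1_d1[OF B]
      by (subst sum.swap) (simp add: sum_negf sum_distrib_right)
    moreover have "(\<Sum>W\<in>B. d2 W (ws ! a) g) * rest ({..<n} - {a}) = - (\<Sum>i<length (ws ! a). A a i)" for a
      unfolding A_def sum_d2[OF B] by (simp add: sum_distrib_right)
    ultimately show ?thesis by (simp add: sum.distrib sum_negf sum_subtractf)
  qed
  also have "(\<Sum>a<n. \<Sum>i<length (ws ! a). A a i + M a i)
      = (\<Sum>(a, i)\<in>Sigma {..<n} (\<lambda>a. {..<length (ws ! a)}). A a i + M a i)"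
    by (simp add: sum.Sigma)
  also have "\<dots> = (\<Sum>(a, i)\<in>active ws. A a i + M a i)"
  proof (rule sum.mono_neutral_right)
    have "A a i + M a i = 0" if "a < n" "i < length (ws ! a)" "(a, i) \<notin> active ws" for a i
    proof -
      have "sign (ws ! a ! i) = 0"
        using that by (simp add: active_def n_def sign_eq_0_iff)
      then show ?thesis by (simp add: A_def M_def)
    qed
    then show "\<forall>s\<in>Sigma {..<n} (\<lambda>a. {..<length (ws ! a)}) - active ws. (case s of (a, i) \<Rightarrow> A a i + M a i) = 0"
      by auto
  qed (auto simp: active_def n_def)
  also have "\<dots> = (\<Sum>s\<in>active ws. of_nat CARD('d) * words_trace ws g
      + (\<Sum>t\<in>active ws - {s}. (sign_at ws s * sign_at ws t) *\<^sub>R joint g ws s t))"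
  proof (intro sum.cong refl)
    fix s assume s: "s \<in> active ws"
    obtain a i where ai: "s = (a, i)" by (cases s)
    show "(case s of (a, i) \<Rightarrow> A a i + M a i) = of_nat CARD('d) * words_trace ws g
      + (\<Sum>t\<in>active ws - {s}. (sign_at ws s * sign_at ws t) *\<^sub>R joint g ws s t)"
      using sum_words_d2_at[OF g s[unfolded ai]]
      by (simp only: ai A_def M_def rest_def n_def prod.case)
  qed
  finally show ?thesis
    by (simp add: sum.distrib mult_ac)
qed

definition contractions :: "'a list list \<Rightarrow> complex^'d^'d \<Rightarrow> complex" where
  "contractions ws g = of_nat CARD('d) * of_nat (card (active ws)) * words_trace ws g
     + (\<Sum>s\<in>active ws. \<Sum>t\<in>active ws - {s}. (sign_at ws s * sign_at ws t) *\<^sub>R joint g ws s t)"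

text \<open>The conjugate function is needed for holonomies, whose adjoints are words.\<close>

theorem casimir_words_trace:
  fixes g :: "complex^'d^'d"
  assumes B: "orthonormal_basis_antiherm B" and g: "g \<in> unitary_group"
  shows "casimir B (words_trace ws) g = - contractions ws g"
    and "casimir B (\<lambda>g. cnj (words_trace ws g)) g = - cnj (contractions ws g)"
proof -
  show "casimir B (words_trace ws) g = - contractions ws g"
    unfolding contractions_def sum_words_d2[OF B g, symmetric]
    by (rule casimir_eqI[OF B g has_lie_deriv_words_trace has_lie_deriv_words_d1])
  have "casimir B (\<lambda>g. cnj (words_trace ws g)) g = (\<Sum>W\<in>B. cnj (words_d2 W ws g))"
    by (rule casimir_eqI[OF B g has_lie_deriv_cnj[OF has_lie_deriv_words_trace]
          has_lie_deriv_cnj[OF has_lie_deriv_words_d1]])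
  also have "\<dots> = cnj (\<Sum>W\<in>B. words_d2 W ws g)"
    by simp
  also have "\<dots> = - cnj (contractions ws g)"
    unfolding contractions_def sum_words_d2[OF B g] by simp
  finally show "casimir B (\<lambda>g. cnj (words_trace ws g)) g = - cnj (contractions ws g)" .
qed

end

section \<open>Loops, their arcs and their holonomies\<close>

lemma self_in_loop_of: "\<xi> \<in> loop_of \<xi>"
  unfolding loop_of_def by (rule CollectI, rule exI[of _ 0]) simp

lemma in_loop_ofD: "\<eta> \<in> loop_of \<xi> \<Longrightarrow> \<exists>k. \<eta> = rotate k \<xi>"
  by (auto simp: loop_of_def)

lemma rep_loop_of: "\<exists>k. rep (loop_of \<xi>) = rotate k \<xi>"
  unfolding rep_def by (rule in_loop_ofD, rule someI, rule self_in_loop_of)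

lemma loop_of_rotate [simp]: "loop_of (rotate k \<xi>) = loop_of \<xi>"
proof (cases "\<xi> = []")
  case False
  \<comment> \<open>A rotation by \<open>k\<close> is undone by one by \<open>length \<xi> * k - k\<close>, a representative of \<open>- k\<close>.\<close>
  have "rotate j \<xi> = rotate (j + (length \<xi> * k - k)) (rotate k \<xi>)" for j
  proof -
    have "k \<le> length \<xi> * k" using False by (cases \<xi>) auto
    then have "j + (length \<xi> * k - k) + k = j + length \<xi> * k" by linarith
    then have "rotate (j + (length \<xi> * k - k)) (rotate k \<xi>) = rotate (j + length \<xi> * k) \<xi>"
      by (simp only: rotate_rotate)
    also have "\<dots> = rotate j \<xi>"
      by (subst (1 2) rotate_conv_mod) simp
    finally show ?thesis by simp
  qed
  then show ?thesis
    by (auto simp: loop_of_def rotate_rotate)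
qed simp

lemma loop_of_rep: "loop_of (rep (loop_of \<xi>)) = loop_of \<xi>"
  using rep_loop_of[of \<xi>] by auto

lemma loop_of_eqD: "loop_of \<eta> = loop_of \<xi> \<Longrightarrow> \<exists>k. \<eta> = rotate k \<xi>"
  using self_in_loop_of[of \<eta>] in_loop_ofD by metis

definition loop_arcs :: "'v list \<Rightarrow> ('v \<times> 'v) list" where
  "loop_arcs \<xi> = zip \<xi> (rotate1 \<xi>)"

lemma length_loop_arcs [simp]: "length (loop_arcs \<xi>) = length \<xi>"
  by (simp add: loop_arcs_def)

lemma loop_arcs_Nil [simp]: "loop_arcs [] = []"
  by (simp add: loop_arcs_def)

lemma nth_loop_arcs: "i < length \<xi> \<Longrightarrow> loop_arcs \<xi> ! i = (\<xi> ! i, nxt \<xi> i)"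
  by (simp add: loop_arcs_def nxt_def nth_rotate1)

lemma loop_arcs_rotate: "loop_arcs (rotate k \<xi>) = rotate k (loop_arcs \<xi>)"
proof (intro nth_equalityI)
  fix i assume "i < length (loop_arcs (rotate k \<xi>))"
  moreover from this have "(k + i) mod length \<xi> < length \<xi>" "Suc i mod length \<xi> < length \<xi>"
    by (auto intro!: mod_less_divisor simp: length_greater_0_conv[symmetric] simp del: length_greater_0_conv)
  ultimately show "loop_arcs (rotate k \<xi>) ! i = rotate k (loop_arcs \<xi>) ! i"
    by (simp add: nth_loop_arcs nth_rotate nxt_def mod_simps)
qed simp

lemma zip_path_append:
  "zip (a # u @ b # v) (u @ b # w) = zip (a # u) (u @ [b]) @ zip (b # v) w"
  using zip_append[of "a # u" "u @ [b]" "b # v" w] by simp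

lemma loop_arcs_append:
  assumes "u \<noteq> []" "v \<noteq> []" "hd u = hd v"
  shows "loop_arcs (u @ v) = loop_arcs u @ loop_arcs v"
  using assms by (cases u; cases v) (simp_all add: loop_arcs_def zip_path_append)

text \<open>The arcs of the two bridges, when a crossing of \<open>(x,y)\<close> and one of \<open>(y,x)\<close> are erased.\<close>

lemma loop_arcs_bridges:
  assumes "hd (u @ [y]) = y" "hd (v @ [x]) = x"
  shows "loop_arcs (x # u @ y # v) = (x, y) # loop_arcs u @ (y, x) # loop_arcs v"
  using assms by (cases u; cases v) (simp_all add: loop_arcs_def zip_path_append)

lemma loop_arcs_tl_append:
  assumes "\<xi> = x # u" "\<eta> = y # v" "u \<noteq> []" "v \<noteq> []" "hd u = y" "hd v = x"
  shows "loop_arcs (u @ v) = tl (loop_arcs \<xi>) @ tl (loop_arcs \<eta>)"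
  using assms by (cases u; cases v) (simp_all add: loop_arcs_def zip_path_append)

definition closed_in :: "'v pair_pre_digraph \<Rightarrow> 'v list \<Rightarrow> bool" where
  "closed_in G \<xi> \<longleftrightarrow> set (loop_arcs \<xi>) \<subseteq> parcs G"

lemma closed_in_based_loops: "\<xi> \<in> based_loops G \<Longrightarrow> closed_in G \<xi>"
  unfolding closed_in_def based_loops_def
  by (auto simp: in_set_conv_nth nth_loop_arcs)

lemma closed_in_rotate [simp]: "closed_in G (rotate k \<xi>) \<longleftrightarrow> closed_in G \<xi>"
  by (simp add: closed_in_def loop_arcs_rotate)

lemma path_holonomy_arcs: "path_holonomy m \<xi> = mprod (rev (map m (loop_arcs \<xi>)))"
proof -
  have "map (\<lambda>i. m (\<xi> ! i, nxt \<xi> i)) [0..<length \<xi>] = map m (loop_arcs \<xi>)"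
    by (rule nth_equalityI) (simp_all add: nth_loop_arcs)
  then show ?thesis by (simp add: path_holonomy_def)
qed

text \<open>The holonomy multiplies along the loop from right to left. Its adjoint multiplies in the
  order in which the loop is written, which is the order of words.\<close>

definition adjoint_conn :: "('v \<times> 'v \<Rightarrow> complex^'d^'d) \<Rightarrow> 'v \<times> 'v \<Rightarrow> complex^'d^'d" where
  "adjoint_conn m e = cadj (m e)"

lemma trace_path_holonomy:
  "trace (path_holonomy m \<xi>) = cnj (word_trace (adjoint_conn m) (loop_arcs \<xi>))"
proof -
  have "cadj (mprod (map (adjoint_conn m) (loop_arcs \<xi>))) = path_holonomy m \<xi>"
    by (simp add: cadj_mprod path_holonomy_arcs adjoint_conn_def comp_def)
  then show ?thesis
    by (simp add: word_trace_def flip: trace_cadj)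
qed

lemma class_trace_q_class: "class_trace (q_class g (loop_of \<xi>)) = word_trace g \<xi>"
proof -
  obtain k where "rep (loop_of \<xi>) = rotate k \<xi>" using rep_loop_of by blast
  then show ?thesis
    by (simp add: q_class_def class_trace_conj_class word_trace_rotate flip: word_trace_def)
qed

lemma class_trace_holonomy:
  "class_trace (holonomy A (loop_of \<xi>)) = trace (path_holonomy (rep A) \<xi>)"
proof -
  obtain k where "rep (loop_of \<xi>) = rotate k \<xi>" using rep_loop_of by blast
  then show ?thesis
    by (simp add: holonomy_def class_trace_conj_class trace_path_holonomy loop_arcs_rotate word_trace_rotate)
qed

lemma connection_unitary: "m \<in> connections G \<Longrightarrow> e \<in> parcs G \<Longrightarrow> m e \<in> unitary_group"
  by (auto simp: connections_def)

lemma connection_reverse: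
  assumes "m \<in> connections G" "(x, y) \<in> parcs G" "(y, x) \<in> parcs G"
  shows "m (x, y) = cadj (m (y, x))"
  using assms connection_unitary[OF assms(1,3)]
  by (auto simp: connections_def simp flip: matrix_inv_unitary)

text \<open>Along a path the gauge factors at the inner vertices cancel; along a closed path the two
  remaining ones are inverse to each other.\<close>

lemma gauge_path:
  assumes h: "h \<in> gauge_group G"
    and m': "\<And>x y. (x, y) \<in> parcs G \<Longrightarrow> m' (x, y) = matrix_inv (h y) ** m (x, y) ** h x"
    and G: "\<And>x y. (x, y) \<in> parcs G \<Longrightarrow> x \<in> pverts G \<and> y \<in> pverts G"
    and "set (zip (v # zs) (zs @ [w])) \<subseteq> parcs G"
  shows "mprod (rev (map m' (zip (v # zs) (zs @ [w]))))
    = cadj (h w) ** mprod (rev (map m (zip (v # zs) (zs @ [w])))) ** h v"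
  using assms(4)
proof (induction zs arbitrary: v)
  case Nil
  then have "h w \<in> unitary_group"
    using G[of v w] h by (auto simp: gauge_group_def)
  with Nil have "m' (v, w) = cadj (h w) ** m (v, w) ** h v"
    using m'[of v w] by (simp add: matrix_inv_unitary)
  then show ?case by (simp add: matrix_mul_rid)
next
  case (Cons z zs)
  have vz: "(v, z) \<in> parcs G" using Cons.prems by simp
  then have z: "h z \<in> unitary_group" using G[of v z] h by (auto simp: gauge_group_def)
  have IH: "mprod (rev (map m' (zip (z # zs) (zs @ [w]))))
      = cadj (h w) ** mprod (rev (map m (zip (z # zs) (zs @ [w])))) ** h z"
    using Cons.prems by (intro Cons.IH) simp
  have zip: "zip (v # z # zs) ((z # zs) @ [w]) = (v, z) # zip (z # zs) (zs @ [w])"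
    by simp
  have "mprod (rev (map m' (zip (v # z # zs) ((z # zs) @ [w]))))
      = cadj (h w) ** mprod (rev (map m (zip (z # zs) (zs @ [w])))) **
        (h z ** cadj (h z)) ** m (v, z) ** h v"
    unfolding zip using m'[OF vz] z
    by (simp add: mprod_append IH matrix_inv_unitary matrix_mul_assoc matrix_mul_rid
        del: zip_Cons_Cons)
  also have "\<dots> = cadj (h w) ** mprod (rev (map m (zip (v # z # zs) ((z # zs) @ [w])))) ** h v"
    unfolding zip using unitary_cancel[OF z]
    by (simp add: mprod_append matrix_mul_assoc matrix_mul_rid del: zip_Cons_Cons)
  finally show ?case .
qed

lemma trace_path_holonomy_gauge:
  assumes "(m, m') \<in> gauge_equiv G" "pair_wf_digraph G" "closed_in G \<xi>"
  shows "trace (path_holonomy m' \<xi>) = trace (path_holonomy m \<xi>)"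
proof (cases \<xi>)
  case Nil
  then show ?thesis by (simp add: path_holonomy_arcs)
next
  case (Cons v zs)
  from assms(1) obtain h where h: "h \<in> gauge_group G"
    and m': "\<And>x y. (x, y) \<in> parcs G \<Longrightarrow> m' (x, y) = matrix_inv (h y) ** m (x, y) ** h x"
    by (auto simp: gauge_equiv_def)
  have G: "x \<in> pverts G \<and> y \<in> pverts G" if "(x, y) \<in> parcs G" for x y
    using pair_wf_digraph.arc_fst_in_verts[OF assms(2) that] pair_wf_digraph.arc_snd_in_verts[OF assms(2) that]
    by simp
  have arcs: "loop_arcs \<xi> = zip (v # zs) (zs @ [v])"
    by (simp add: Cons loop_arcs_def)
  then have "(v, hd (zs @ [v])) \<in> parcs G"
    using assms(3) by (cases zs) (auto simp: closed_in_def)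
  then have v: "h v \<in> unitary_group" using G h by (auto simp: gauge_group_def)
  have "path_holonomy m' \<xi> = cadj (h v) ** path_holonomy m \<xi> ** h v"
    unfolding path_holonomy_arcs arcs
    by (rule gauge_path[OF h m' G]) (use assms(3) arcs in \<open>auto simp: closed_in_def\<close>)
  also have "trace \<dots> = trace (h v ** (cadj (h v) ** path_holonomy m \<xi>))"
    by (rule trace_mul_sym)
  also have "\<dots> = trace (path_holonomy m \<xi>)"
    using unitary_cancel[OF v] by (simp add: matrix_mul_assoc matrix_mul_lid)
  finally show ?thesis .
qed

lemma gauge_equiv_refl:
  fixes m :: "'v \<times> 'v \<Rightarrow> complex^'d^'d"
  assumes "m \<in> connections G" "pair_wf_digraph G"
  shows "(m, m) \<in> gauge_equiv G"
proof -
  define h where "h = restrict (\<lambda>_. mat 1 :: complex^'d^'d) (pverts G)"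
  have "h \<in> gauge_group G"
    by (simp add: h_def gauge_group_def unitary_one restrict_PiE)
  moreover have "m (x, y) = matrix_inv (h y) ** m (x, y) ** h x" if "(x, y) \<in> parcs G" for x y
    using pair_wf_digraph.arc_fst_in_verts[OF assms(2) that] pair_wf_digraph.arc_snd_in_verts[OF assms(2) that]
    by (simp add: h_def matrix_inv_unitary unitary_one matrix_mul_lid matrix_mul_rid)
  ultimately have "\<exists>h\<in>gauge_group G. \<forall>(x, y)\<in>parcs G. m (x, y) = matrix_inv (h y) ** m (x, y) ** h x"
    by (intro bexI[of _ h]) auto
  then show ?thesis
    using assms(1) by (simp add: gauge_equiv_def)
qed

lemma class_trace_holonomy_moduli:
  assumes "A \<in> moduli G" "m \<in> A" "pair_wf_digraph G" "closed_in G \<xi>"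
  shows "class_trace (holonomy A (loop_of \<xi>)) = cnj (word_trace (adjoint_conn m) (loop_arcs \<xi>))"
proof -
  from assms(1) obtain m0 where "A = gauge_equiv G `` {m0}"
    by (auto simp: moduli_def quotient_def)
  moreover have "rep A \<in> A"
    unfolding rep_def by (rule someI[of "\<lambda>a. a \<in> A", OF assms(2)])
  ultimately have "(m0, rep A) \<in> gauge_equiv G" "(m0, m) \<in> gauge_equiv G"
    using assms(2) by auto
  then have "trace (path_holonomy (rep A) \<xi>) = trace (path_holonomy m \<xi>)"
    by (simp only: trace_path_holonomy_gauge[OF _ assms(3,4)])
  then show ?thesis
    by (simp add: class_trace_holonomy trace_path_holonomy)
qed

lemma modulus_in_moduli: "m \<in> connections G \<Longrightarrow> modulus G m \<in> moduli G"
  by (auto simp: modulus_def moduli_def quotient_def)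

lemma moduli_connections: "A \<in> moduli G \<Longrightarrow> m \<in> A \<Longrightarrow> m \<in> connections G"
  by (auto simp: moduli_def quotient_def gauge_equiv_def)

section \<open>Reduction of loops\<close>

text \<open>Induction on the length. A place of backtracking can be rotated to the front and removed, since a
  closed walk of length one would be a loop edge.\<close>

lemma ex_reduced:
  assumes "pair_loopfree_digraph G" "closed_in G \<xi>"
  shows "\<exists>l'. remove_pair\<^sup>*\<^sup>* (loop_of \<xi>) l' \<and> l' \<in> loop_of ` Collect nonbacktracking"
  using assms(2)
proof (induction \<xi> rule: length_induct)
  case (1 \<xi>)
  show ?case
  proof (cases "nonbacktracking \<xi>")
    case True
    then show ?thesis by blast
  next
    case False
    then obtain i where i: "i < length \<xi>" "\<xi> ! i = \<xi> ! ((i + 2) mod length \<xi>)"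
      by (auto simp: nonbacktracking_def)
    define \<eta> where "\<eta> = rotate i \<xi>"
    have \<eta>: "closed_in G \<eta>" "loop_of \<eta> = loop_of \<xi>" "length \<eta> = length \<xi>"
      using 1 by (simp_all add: \<eta>_def)
    have ends: "\<eta> ! 0 = \<eta> ! (2 mod length \<eta>)"
    proof -
      have "0 < length \<xi>" using i by auto
      then show ?thesis using i by (simp add: \<eta>_def nth_rotate mod_simps)
    qed
    obtain x ys where x: "\<eta> = x # ys" using i \<eta>(3) by (cases \<eta>) auto
    have "ys \<noteq> []"
    proof
      assume "ys = []"
      then have "(x, x) \<in> parcs G" using \<eta>(1) by (simp add: x closed_in_def loop_arcs_def)
      then show False using pair_loopfree_digraph.pair_no_loops[OF assms(1)] by fastforce
    qed
    then obtain y zs where yz: "\<eta> = x # y # zs" using x by (cases ys) auto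
    have hd: "hd (zs @ [x]) = x"
      using ends by (cases zs) (auto simp: yz mod_if)
    have "closed_in G zs"
      using \<eta>(1) loop_arcs_bridges[of "[]" y zs x] hd by (simp add: closed_in_def yz)
    moreover have "length zs < length \<xi>" using \<eta>(3) by (simp add: yz)
    ultimately obtain l' where l': "remove_pair\<^sup>*\<^sup>* (loop_of zs) l'" "l' \<in> loop_of ` Collect nonbacktracking"
      using 1 by blast
    have "remove_pair (loop_of \<xi>) (loop_of zs)"
      unfolding remove_pair_def using hd \<eta>(2) yz by metis
    then show ?thesis using l' converse_rtranclp_into_rtranclp by metis
  qed
qed

text \<open>The removed pair contributes the factor \<open>V (x, y) V (y, x) = 1\<close>.\<close>

lemma remove_pair_invariant:
  assumes "remove_pair\<^sup>*\<^sup>* (loop_of \<xi>) l'" "closed_in G \<xi>"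
    and V: "\<And>x y. (x, y) \<in> parcs G \<Longrightarrow> (y, x) \<in> parcs G \<Longrightarrow> V (x, y) ** V (y, x) = mat 1"
  shows "\<exists>\<eta>. l' = loop_of \<eta> \<and> closed_in G \<eta> \<and>
    word_trace V (loop_arcs \<eta>) = word_trace V (loop_arcs \<xi>)"
  using assms(1)
proof (induction rule: rtranclp_induct)
  case base
  then show ?case using assms(2) by blast
next
  case (step l l')
  then obtain \<eta> where \<eta>: "l = loop_of \<eta>" "closed_in G \<eta>"
    "word_trace V (loop_arcs \<eta>) = word_trace V (loop_arcs \<xi>)" by blast
  from step(2) obtain x y zs where z: "loop_of (x # y # zs) = loop_of \<eta>" "hd (zs @ [x]) = x" "l' = loop_of zs"
    by (auto simp: remove_pair_def \<eta>)
  then obtain k where k: "x # y # zs = rotate k \<eta>" using loop_of_eqD by blast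
  have arcs: "loop_arcs (x # y # zs) = (x, y) # (y, x) # loop_arcs zs"
    using loop_arcs_bridges[of "[]" y zs x] z by simp
  have closed: "closed_in G (x # y # zs)" using \<eta>(2) by (simp add: k)
  have "word_trace V (loop_arcs (x # y # zs)) = word_trace V (loop_arcs \<xi>)"
    using \<eta>(3) by (simp add: k loop_arcs_rotate word_trace_rotate)
  moreover have "word_trace V (loop_arcs (x # y # zs)) = word_trace V (loop_arcs zs)"
    using closed V[of x y] by (simp add: closed_in_def arcs word_trace_def matrix_mul_assoc matrix_mul_lid)
  ultimately show ?case
    using closed z by (auto simp: closed_in_def arcs)
qed

lemma reduced_invariant:
  assumes "pair_loopfree_digraph G" "closed_in G \<xi>"
    and V: "\<And>x y. (x, y) \<in> parcs G \<Longrightarrow> (y, x) \<in> parcs G \<Longrightarrow> V (x, y) ** V (y, x) = mat 1"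
  shows "\<exists>\<eta>. reduced (loop_of \<xi>) = loop_of \<eta> \<and> closed_in G \<eta> \<and>
    word_trace V (loop_arcs \<eta>) = word_trace V (loop_arcs \<xi>)"
proof -
  have "remove_pair\<^sup>*\<^sup>* (loop_of \<xi>) (reduced (loop_of \<xi>))"
    unfolding reduced_def using someI_ex[OF ex_reduced[OF assms(1,2)]] by blast
  then show ?thesis
    by (rule remove_pair_invariant) (use assms in auto)
qed


section \<open>Collections given by a list of based loops\<close>

lemma based_loops_iff: "\<xi> \<in> based_loops G \<longleftrightarrow> \<xi> \<noteq> [] \<and> closed_in G \<xi>"
proof
  assume "\<xi> \<noteq> [] \<and> closed_in G \<xi>"
  then have "\<forall>i<length \<xi>. loop_arcs \<xi> ! i \<in> parcs G"
    by (auto simp: closed_in_def subset_eq)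
  then show "\<xi> \<in> based_loops G"
    using \<open>\<xi> \<noteq> [] \<and> closed_in G \<xi>\<close> by (auto simp: based_loops_def nth_loop_arcs)
qed (auto simp: closed_in_based_loops, auto simp: based_loops_def)

lemma mset_listing: "mset (listing L) = image_mset rep L"
proof -
  have "mset (SOME ls. mset ls = L) = L"
    by (rule someI_ex) (rule ex_mset)
  then show ?thesis by (simp add: listing_def)
qed

lemma listing_based_loops:
  assumes "set_mset L \<subseteq> loops G" "b \<in> set (listing L)"
  shows "b \<in> based_loops G"
proof -
  have "b \<in># image_mset rep L"
    using assms(2) by (simp flip: mset_listing)
  then obtain \<xi> where "\<xi> \<in> based_loops G" "b = rep (loop_of \<xi>)"
    using assms(1) by (auto simp: loops_def)
  moreover obtain k where "rep (loop_of \<xi>) = rotate k \<xi>" using rep_loop_of by blast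
  ultimately show ?thesis
    by (simp add: based_loops_iff)
qed

lemma mset_loop_of_listing:
  assumes "set_mset L \<subseteq> loops G"
  shows "mset (map loop_of (listing L)) = L"
proof -
  have "mset (map loop_of (listing L)) = image_mset (\<lambda>l. loop_of (rep l)) L"
    by (simp add: mset_listing multiset.map_comp comp_def)
  also have "\<dots> = image_mset (\<lambda>l. l) L"
    by (intro image_mset_cong) (use assms loop_of_rep in \<open>auto simp: loops_def\<close>)
  finally show ?thesis by simp
qed

text \<open>The members of a listed collection with numbers in \<open>C\<close>. Removing members of the collection becomes
  removing indices, which keeps track of loops that occur more than once.\<close>

definition subcollection :: "'v list list \<Rightarrow> nat set \<Rightarrow> 'v collection" where
  "subcollection bs C = image_mset (\<lambda>c. loop_of (bs ! c)) (mset_set C)"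

lemma subcollection_all: "mset (map loop_of bs) = subcollection bs {..<length bs}"
proof -
  have "map loop_of bs = map (\<lambda>c. loop_of (bs ! c)) [0..<length bs]"
    by (rule nth_equalityI) simp_all
  then show ?thesis
    by (simp add: subcollection_def atLeast0LessThan)
qed

lemma subcollection_diff:
  "\<lbrakk>finite C; a \<in> C\<rbrakk> \<Longrightarrow> subcollection bs C - {#loop_of (bs ! a)#} = subcollection bs (C - {a})"
  by (simp add: subcollection_def mset_set.remove)

lemma prod_subcollection:
  "(\<Prod>l\<in>#subcollection bs C. F l) = (\<Prod>c\<in>C. F (loop_of (bs ! c)))"
  by (simp add: subcollection_def prod_unfold_prod_mset multiset.map_comp comp_def)

lemma split_merge_eq:
  fixes bs :: "'v list list" and a b i j :: nat
  assumes "a < length bs" "b < length bs" "(a, i) \<noteq> (b, j)"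
  defines "\<xi> \<equiv> rotate i (bs ! a)" and "k \<equiv> (j + length (bs ! a) - i) mod length (bs ! a)"
  shows "split_merge bs (a, i) (b, j) =
    (if a \<noteq> b then
       add_mset (loop_of (\<xi> @ rotate j (bs ! b))) (subcollection bs ({..<length bs} - {a} - {b}))
     else
       add_mset (loop_of (take k \<xi>)) (add_mset (loop_of (drop k \<xi>)) (subcollection bs ({..<length bs} - {a}))))"
proof -
  have "subcollection bs {..<length bs} - {#loop_of (bs ! a), loop_of (bs ! b)#}
      = subcollection bs ({..<length bs} - {a} - {b})" if "a \<noteq> b"
  proof -
    have "subcollection bs {..<length bs} - {#loop_of (bs ! a), loop_of (bs ! b)#}
        = subcollection bs {..<length bs} - {#loop_of (bs ! a)#} - {#loop_of (bs ! b)#}"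
      unfolding diff_diff_add_mset by (simp add: add_mset_commute)
    then show ?thesis using assms that by (simp add: subcollection_diff)
  qed
  moreover have "subcollection bs {..<length bs} - {#loop_of (bs ! a)#} = subcollection bs ({..<length bs} - {a})"
    using assms by (intro subcollection_diff) auto
  ultimately show ?thesis
    using assms(3) unfolding split_merge_def subcollection_all Let_def \<xi>_def k_def
    by (auto simp: add_mset_commute)
qed

lemma neg_split_merge_eq:
  fixes bs :: "'v list list" and a b i j :: nat
  assumes "a < length bs" "b < length bs"
  defines "\<xi> \<equiv> rotate i (bs ! a)" and "k \<equiv> (j + length (bs ! a) - i) mod length (bs ! a)"
    and "l \<equiv> reduced (loop_of (tl (rotate i (bs ! a)) @ tl (rotate j (bs ! b))))"
    and "rest \<equiv> subcollection bs ({..<length bs} - {a} - {b})"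
  shows "neg_split_merge bs (a, i) (b, j) =
    (if a \<noteq> b then if l = trivial_loop \<and> rest = {#} then {#} else add_mset l rest
     else
       add_mset (loop_of (take (k - 1) (tl \<xi>))) (add_mset (loop_of (drop (k + 1) \<xi>))
         (subcollection bs ({..<length bs} - {a}))))"
proof -
  have "subcollection bs {..<length bs} - {#loop_of (bs ! a), loop_of (bs ! b)#} = rest" if "a \<noteq> b"
  proof -
    have "subcollection bs {..<length bs} - {#loop_of (bs ! a), loop_of (bs ! b)#}
        = subcollection bs {..<length bs} - {#loop_of (bs ! a)#} - {#loop_of (bs ! b)#}"
      unfolding diff_diff_add_mset by (simp add: add_mset_commute)
    then show ?thesis using assms that by (simp add: subcollection_diff)
  qed
  moreover have "subcollection bs {..<length bs} - {#loop_of (bs ! a)#} = subcollection bs ({..<length bs} - {a})"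
    using assms by (intro subcollection_diff) auto
  ultimately show ?thesis
    unfolding neg_split_merge_def subcollection_all Let_def \<xi>_def k_def l_def
    by (auto simp: add_mset_commute)
qed

section \<open>Transition kernels as double sums over indices\<close>

text \<open>The probability of each pair of indices is the reciprocal of the number of pairs, so multiplying
  by this number, the rate in the operators, leaves the plain sum over pairs. Both sides
  vanish if there are no pairs.\<close>

lemma kernel_act_pair:
  fixes f :: "'i \<Rightarrow> 'j \<Rightarrow> 'v collection"
  assumes "finite I" "finite J"
    and K: "K L = map_pmf (\<lambda>(s, t). f s t) (pair_pmf (pmf_of_set I) (pmf_of_set J))"
  shows "of_nat (card I * card J) * kernel_act K F L = (\<Sum>s\<in>I. \<Sum>t\<in>J. F (f s t))"
proof (cases "I = {} \<or> J = {}")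
  case True
  then show ?thesis by auto
next
  case False
  then have ne: "I \<noteq> {}" "J \<noteq> {}" by auto
  let ?M = "pair_pmf (pmf_of_set I) (pmf_of_set J)"
  have sets: "set_pmf (pmf_of_set I) = I" "set_pmf (pmf_of_set J) = J"
    using assms False by auto
  have "kernel_act K F L = measure_pmf.expectation (K L) F"
    unfolding kernel_act_def K
    by (subst integral_measure_pmf[of "set_pmf (map_pmf (\<lambda>(s, t). f s t) ?M)"])
       (use assms sets in \<open>auto simp: scaleR_conv_of_real\<close>)
  also have "\<dots> = measure_pmf.expectation ?M (\<lambda>p. F (case p of (s, t) \<Rightarrow> f s t))"
    unfolding K by (rule integral_map_pmf)
  also have "\<dots> = (\<Sum>p\<in>I \<times> J. pmf ?M p *\<^sub>R F (case p of (s, t) \<Rightarrow> f s t))"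
    using assms sets by (intro integral_measure_pmf) auto
  also have "\<dots> = (\<Sum>p\<in>I \<times> J. F (case p of (s, t) \<Rightarrow> f s t) / of_nat (card I * card J))"
  proof (intro sum.cong refl)
    fix p assume "p \<in> I \<times> J"
    then obtain s t where "p = (s, t)" "s \<in> I" "t \<in> J" by blast
    then show "pmf ?M p *\<^sub>R F (case p of (s, t) \<Rightarrow> f s t)
        = F (case p of (s, t) \<Rightarrow> f s t) / of_nat (card I * card J)"
      using assms(1,2) ne by (simp add: pmf_pair pmf_of_set scaleR_conv_of_real)
  qed
  also have "\<dots> = (\<Sum>s\<in>I. \<Sum>t\<in>J. F (f s t)) / of_nat (card I * card J)"
    by (simp add: sum_divide_distrib sum.cartesian_product split_def)
  finally show ?thesis using assms False by simp
qed

text \<open>Equal indices leave the collection unchanged and contribute the term with the factor \<open>card I\<close>.\<close>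

lemma kernel_act_self:
  fixes F :: "'v collection \<Rightarrow> complex"
  assumes "finite I" "\<And>s. s \<in> I \<Longrightarrow> f s s = L"
    and K: "K L = map_pmf (\<lambda>(s, t). f s t) (pair_pmf (pmf_of_set I) (pmf_of_set I))"
  shows "of_nat ((card I)\<^sup>2) * (kernel_act K F L - F L)
    = of_nat (card I) * F L + (\<Sum>s\<in>I. \<Sum>t\<in>I - {s}. F (f s t)) - of_nat ((card I)\<^sup>2) * F L"
proof -
  have "of_nat ((card I)\<^sup>2) * kernel_act K F L = (\<Sum>s\<in>I. \<Sum>t\<in>I. F (f s t))"
    using kernel_act_pair[of I I K L f F] assms by (simp add: power2_eq_square)
  also have "\<dots> = (\<Sum>s\<in>I. F L + (\<Sum>t\<in>I - {s}. F (f s t)))"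
    using assms(1,2) by (intro sum.cong refl) (simp add: sum.remove)
  finally show ?thesis
    by (simp add: sum.distrib right_diff_distrib)
qed

lemma visit_indices_Sigma:
  "visit_indices x bs = Sigma {..<length bs} (\<lambda>a. {i. i < length (bs ! a) \<and> bs ! a ! i = x})"
  by (auto simp: visit_indices_def)

lemma crossing_indices_Sigma:
  "crossing_indices x y bs =
    Sigma {..<length bs} (\<lambda>a. {i. i < length (bs ! a) \<and> bs ! a ! i = x \<and> nxt (bs ! a) i = y})"
  by (auto simp: crossing_indices_def)

lemma finite_indices [simp]: "finite (visit_indices x bs)" "finite (crossing_indices x y bs)"
  by (auto simp: visit_indices_Sigma crossing_indices_Sigma)

lemma sum_mset_listing: "(\<Sum>l\<in>#L. f (rep l)) = (\<Sum>a<length (listing L). f (listing L ! a))"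
proof -
  have "(\<Sum>l\<in>#L. f (rep l)) = sum_mset (image_mset f (mset (listing L)))"
    by (simp add: mset_listing multiset.map_comp comp_def)
  also have "\<dots> = sum_list (map f (listing L))"
    by (simp flip: sum_mset_sum_list)
  finally show ?thesis
    by (simp add: sum_list_sum_nth atLeast0LessThan)
qed

lemma N_edge_card: "N_edge x y L = card (crossing_indices x y (listing L))"
  by (simp add: N_edge_def loop_cross_def Let_def crossing_indices_Sigma
      sum_mset_listing[of "\<lambda>\<xi>. card {i. i < length \<xi> \<and> \<xi> ! i = x \<and> nxt \<xi> i = y}"])

lemma N_vert_sum: "N_vert G x L = (\<Sum>y\<in>pverts G. N_edge x y L)"
  unfolding N_vert_def N_edge_def loop_visits_def
  by (induction L) (simp_all add: sum.distrib)

lemma N_vert_card: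
  assumes "pair_fin_digraph G" "set_mset L \<subseteq> loops G"
  shows "N_vert G x L = card (visit_indices x (listing L))"
proof -
  let ?bs = "listing L"
  have "visit_indices x ?bs = (\<Union>y\<in>pverts G. crossing_indices x y ?bs)"
  proof (intro equalityI subsetI)
    fix s assume "s \<in> visit_indices x ?bs"
    then obtain a i where s: "s = (a, i)" "a < length ?bs" "i < length (?bs ! a)" "?bs ! a ! i = x"
      by (auto simp: visit_indices_def)
    then have "(x, nxt (?bs ! a) i) \<in> parcs G"
      using listing_based_loops[OF assms(2), of "?bs ! a"] by (auto simp: based_loops_def)
    then have "nxt (?bs ! a) i \<in> pverts G"
      using pair_wf_digraph.arc_snd_in_verts[OF pair_fin_digraph.axioms(1)[OF assms(1)]] by fastforce
    then show "s \<in> (\<Union>y\<in>pverts G. crossing_indices x y ?bs)"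
      using s by (auto simp: crossing_indices_def)
  qed (auto simp: visit_indices_def crossing_indices_def)
  then show ?thesis
    unfolding N_vert_sum N_edge_card
    by (subst card_UN_disjoint[symmetric])
       (simp_all add: pair_fin_digraph.pair_finite_verts[OF assms(1)], auto simp: crossing_indices_def)
qed

section \<open>The gauge group\<close>

lemma T_gauge_subcollection: "T_gauge g (subcollection bs C) = (\<Prod>c\<in>C. word_trace g (bs ! c))"
  by (simp add: T_gauge_def prod_subcollection class_trace_q_class)

lemma T_gauge_add_mset: "T_gauge g (add_mset (loop_of \<xi>) L) = word_trace g \<xi> * T_gauge g L"
  by (simp add: T_gauge_def class_trace_q_class)

text \<open>All active letters are of the same kind here, and the words are the loops themselves.\<close>

lemma joint_T_gauge:
  fixes g :: "'v \<Rightarrow> complex^'d^'d"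
  assumes "s \<in> visit_indices x bs" "t \<in> visit_indices x bs" "s \<noteq> t"
  shows "words_in_one_variable.joint {x} {} g (g x) bs s t = T_gauge g (split_merge bs s t)"
proof -
  interpret words_in_one_variable "{x}" "{}" g by unfold_locales simp
  have val: "val (g x) = g" by (auto simp: val_def fun_eq_iff)
  obtain a i b j where st: "s = (a, i)" "t = (b, j)" by (cases s; cases t)
  have a: "a < length bs" "i < length (bs ! a)" "bs ! a ! i = x"
    and b: "b < length bs" "j < length (bs ! b)" "bs ! b ! j = x"
    using assms by (auto simp: st visit_indices_def)
  show ?thesis
  proof (cases "a = b")
    case True
    then have "i \<noteq> j" using assms(3) st by auto
    then show ?thesis
      using a b True rotate_offset(3,4)[of i "bs ! a" j]
      by (simp add: st split_merge_eq joint_def split_term_def same_kind_def val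
          T_gauge_add_mset T_gauge_subcollection mult.assoc)
  next
    case False
    then show ?thesis
      using a b
      by (simp add: st split_merge_eq joint_def merge_term_def same_kind_def val hd_rotate
          T_gauge_add_mset T_gauge_subcollection)
  qed
qed

lemma split_merge_self: "split_merge bs s s = mset (map loop_of bs)"
  by (cases s) (simp add: split_merge_def)

text \<open>The coordinate at \<open>x\<close> occurs in the words exactly at the visits of \<open>x\<close>.\<close>

lemma casimir_coord_T_gauge:
  fixes g :: "'v \<Rightarrow> complex^'d^'d"
  assumes B: "orthonormal_basis_antiherm B" and L: "set_mset L \<subseteq> loops G" and g: "g x \<in> unitary_group"
  defines "V \<equiv> visit_indices x (listing L)"
  shows "casimir_coord B x (\<lambda>u. T_gauge u L) g = - (of_nat CARD('d) * of_nat (card V) * T_gauge g L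
    + (\<Sum>s\<in>V. \<Sum>t\<in>V - {s}. T_gauge g (split_merge (listing L) s t)))"
proof -
  interpret words_in_one_variable "{x}" "{}" g by unfold_locales simp
  let ?bs = "listing L"
  have T: "T_gauge u L = (\<Prod>c<length ?bs. word_trace u (?bs ! c))" for u :: "'v \<Rightarrow> complex^'d^'d"
  proof -
    have "subcollection ?bs {..<length ?bs} = L"
      by (simp only: subcollection_all[symmetric] mset_loop_of_listing[OF L])
    then show ?thesis
      using T_gauge_subcollection[of u ?bs "{..<length ?bs}"] by simp
  qed
  have "T_gauge (g(x := h)) L = words_trace ?bs h" for h
  proof -
    have "val h = g(x := h)" by (auto simp: val_def fun_eq_iff)
    then show ?thesis by (simp add: T words_trace_def)
  qed
  then have "casimir_coord B x (\<lambda>u. T_gauge u L) g = - contractions ?bs (g x)"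
    by (simp add: casimir_coord_def casimir_words_trace[OF B g, of ?bs, symmetric])
  also have "contractions ?bs (g x) = of_nat CARD('d) * of_nat (card V) * T_gauge g L
    + (\<Sum>s\<in>V. \<Sum>t\<in>V - {s}. T_gauge g (split_merge ?bs s t))"
  proof -
    have act: "active ?bs = V" by (simp add: active_def V_def visit_indices_def)
    have "val (g x) = g" by (auto simp: val_def fun_eq_iff)
    then have "words_trace ?bs (g x) = T_gauge g L" by (simp add: T words_trace_def)
    moreover have "(\<Sum>s\<in>V. \<Sum>t\<in>V - {s}. (sign_at ?bs s * sign_at ?bs t) *\<^sub>R joint (g x) ?bs s t)
        = (\<Sum>s\<in>V. \<Sum>t\<in>V - {s}. T_gauge g (split_merge ?bs s t))"
    proof (intro sum.cong refl)
      fix s t assume "s \<in> V" "t \<in> V - {s}"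
      moreover from this have "sign_at ?bs s = 1" "sign_at ?bs t = 1"
        by (auto simp: V_def visit_indices_def sign_at_def sign_def)
      ultimately show "(sign_at ?bs s * sign_at ?bs t) *\<^sub>R joint (g x) ?bs s t = T_gauge g (split_merge ?bs s t)"
        using joint_T_gauge[of s x ?bs t g] by (auto simp: V_def)
    qed
    ultimately show ?thesis by (simp add: contractions_def act)
  qed
  finally show ?thesis .
qed

text \<open>Vertex by vertex, the term \<open>d N\<^sub>x\<close> of the Casimir operator is \<open>(d - 1) N\<^sub>x\<close> plus the \<open>N\<^sub>x\<close> pairs of
  equal indices in \<open>N\<^sub>x\<^sup>2 Q\<^sub>x\<close>, and the remaining pairs agree one by one.\<close>

theorem casimir_gauge_T_gauge:
  fixes g :: "'v \<Rightarrow> complex^'d^'d"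
  assumes G: "pair_fin_digraph G" and B: "orthonormal_basis_antiherm B"
    and g: "g \<in> gauge_group G" and L: "set_mset L \<subseteq> loops G"
  shows "casimir_gauge G B (\<lambda>g'. T_gauge g' L) g =
    - ((of_nat CARD('d) - 1) * of_nat (S_occ G L) * T_gauge g L
       + of_nat (V_occ G L) * T_gauge g L + B_SM G (T_gauge g) L)"
proof -
  let ?d = "of_nat CARD('d) :: complex" and ?T = "T_gauge g L"
  have vertex: "casimir_coord B x (\<lambda>u. T_gauge u L) g =
      - ((?d - 1) * of_nat (N_vert G x L) * ?T + of_nat ((N_vert G x L)\<^sup>2) * ?T
         + of_nat ((N_vert G x L)\<^sup>2) * (kernel_act (Q_kernel x) (T_gauge g) L - ?T))"
    if "x \<in> pverts G" for x
  proof -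
    have "g x \<in> unitary_group" using g that by (auto simp: gauge_group_def)
    note casimir_coord_T_gauge[where g = g and x = x, OF B L this]
    moreover have "of_nat ((N_vert G x L)\<^sup>2) * (kernel_act (Q_kernel x) (T_gauge g) L - ?T)
        = of_nat (N_vert G x L) * ?T
          + (\<Sum>s\<in>visit_indices x (listing L). \<Sum>t\<in>visit_indices x (listing L) - {s}.
              T_gauge g (split_merge (listing L) s t)) - of_nat ((N_vert G x L)\<^sup>2) * ?T"
      unfolding N_vert_card[OF G L]
      by (rule kernel_act_self)
         (simp_all add: Q_kernel_def Let_def split_merge_self mset_loop_of_listing[OF L] del: mset_map)
    ultimately show ?thesis
      by (simp add: N_vert_card[OF G L] algebra_simps)
  qed
  show ?thesis
    unfolding casimir_gauge_def S_occ_def V_occ_def B_SM_def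
    by (simp add: vertex sum_negf sum.distrib sum_subtractf sum_distrib_left sum_distrib_right del: of_nat_power)
qed


section \<open>One edge of a connection\<close>

text \<open>Both parts of a loop cut at two visits of the same vertex are again closed.\<close>

lemma loop_arcs_take_drop:
  assumes "0 < k" "k < length \<xi>" "\<xi> ! k = \<xi> ! 0"
  shows "loop_arcs (take k \<xi>) = take k (loop_arcs \<xi>)" "loop_arcs (drop k \<xi>) = drop k (loop_arcs \<xi>)"
proof -
  have "hd (take k \<xi>) = hd (drop k \<xi>)"
    using assms by (cases \<xi>) (auto simp: hd_drop_conv_nth hd_conv_nth)
  then have "loop_arcs (take k \<xi> @ drop k \<xi>) = loop_arcs (take k \<xi>) @ loop_arcs (drop k \<xi>)"
    using assms by (intro loop_arcs_append) auto
  then have "loop_arcs \<xi> = loop_arcs (take k \<xi>) @ loop_arcs (drop k \<xi>)"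
    by simp
  then show "loop_arcs (take k \<xi>) = take k (loop_arcs \<xi>)" "loop_arcs (drop k \<xi>) = drop k (loop_arcs \<xi>)"
    using assms by simp_all
qed

lemma loop_arcs_erase:
  assumes k: "0 < k" "k < length \<xi>" and e: "loop_arcs \<xi> ! 0 = (x, y)" "loop_arcs \<xi> ! k = (y, x)"
  shows "loop_arcs (take (k - 1) (tl \<xi>)) = take (k - 1) (tl (loop_arcs \<xi>))"
    and "loop_arcs (drop (k + 1) \<xi>) = drop (k + 1) (loop_arcs \<xi>)"
proof -
  define u v where "u = take (k - 1) (tl \<xi>)" and "v = drop (k + 1) \<xi>"
  have nth: "\<xi> ! 0 = x" "nxt \<xi> 0 = y" "\<xi> ! k = y" "nxt \<xi> k = x"
    using e k nth_loop_arcs[of 0 \<xi>] nth_loop_arcs[of k \<xi>] by (cases \<xi>; auto)+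
  have \<xi>: "\<xi> = x # u @ y # v"
    using id_take_nth_drop[OF k(2)] k nth by (cases \<xi>; cases k) (auto simp: u_def v_def)
  have len: "length u = k - 1" using k by (simp add: u_def)
  have "hd (u @ [y]) = y"
    using nth(2) by (cases u) (auto simp: \<xi> nxt_def)
  moreover have "hd (v @ [x]) = x"
    using nth(4) len k by (cases v) (auto simp: \<xi> nxt_def nth_append)
  ultimately have "loop_arcs \<xi> = (x, y) # loop_arcs u @ (y, x) # loop_arcs v"
    unfolding \<xi> by (rule loop_arcs_bridges)
  then show "loop_arcs (take (k - 1) (tl \<xi>)) = take (k - 1) (tl (loop_arcs \<xi>))"
    "loop_arcs (drop (k + 1) \<xi>) = drop (k + 1) (loop_arcs \<xi>)"
    unfolding u_def[symmetric] v_def[symmetric] using k len by (cases k; simp)+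
qed

lemma loop_arcs_merge:
  assumes "x \<noteq> y" "\<xi> \<noteq> []" "\<eta> \<noteq> []" "loop_arcs \<xi> ! 0 = (x, y)" "loop_arcs \<eta> ! 0 = (y, x)"
  shows "loop_arcs (tl \<xi> @ tl \<eta>) = tl (loop_arcs \<xi>) @ tl (loop_arcs \<eta>)"
proof -
  have cons: "\<exists>u. \<zeta> = p # u \<and> u \<noteq> [] \<and> hd u = q"
    if pq: "p \<noteq> q" and ne: "\<zeta> \<noteq> []" and e: "loop_arcs \<zeta> ! 0 = (p, q)" for \<zeta> :: "'a list" and p q
  proof -
    have "\<zeta> ! 0 = p" "nxt \<zeta> 0 = q" using ne e nth_loop_arcs[of 0 \<zeta>] by auto
    moreover obtain c u where \<zeta>: "\<zeta> = c # u" using ne by (cases \<zeta>) auto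
    ultimately show ?thesis using pq by (cases u) (auto simp: nxt_def)
  qed
  obtain u where u: "\<xi> = x # u" "u \<noteq> []" "hd u = y" using cons[of x y \<xi>] assms by blast
  obtain v where v: "\<eta> = y # v" "v \<noteq> []" "hd v = x" using cons[of y x \<eta>] assms by blast
  show ?thesis
    using loop_arcs_tl_append[OF u(1) v(1) u(2) v(2) u(3) v(3)] u v by simp
qed

lemma tau_nonempty: "L \<noteq> {#} \<Longrightarrow> tau A L = (\<Prod>l\<in>#L. class_trace (holonomy A l))"
  by (simp add: tau_def)

lemma symmetric_arcs: "pair_graph G \<Longrightarrow> (x, y) \<in> parcs G \<Longrightarrow> (y, x) \<in> parcs G"
  by (auto simp: pair_graph_def pair_pseudo_graph_def pair_sym_digraph_def pair_sym_digraph_axioms_def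
      symmetric_def sym_def)

text \<open>The words of the edge \<open>{x,y}\<close> are the lists of arcs of the loops, read with adjoint matrices. The
  variable is the matrix of \<open>(x,y)\<close>; because of the adjoint, crossings of \<open>(x,y)\<close> carry its inverse
  and crossings of \<open>(y,x)\<close> carry the variable itself.\<close>

locale edge_variable =
  fixes G :: "'v pair_pre_digraph" and A :: "('v \<times> 'v \<Rightarrow> complex^'d^'d) set"
    and m :: "'v \<times> 'v \<Rightarrow> complex^'d^'d" and x y :: 'v and bs :: "'v list list"
  assumes graph: "pair_graph G" and A: "A \<in> moduli G" and m: "m \<in> A"
    and edge: "(x, y) \<in> parcs G" and based: "\<And>b. b \<in> set bs \<Longrightarrow> b \<in> based_loops G"
begin

lemma wf: "pair_wf_digraph G" and loopfree: "pair_loopfree_digraph G"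
  using graph unfolding pair_graph_def pair_digraph_def pair_loopfree_digraph_def by auto

lemma edge': "(y, x) \<in> parcs G"
  by (rule symmetric_arcs[OF graph edge])

lemma neq: "x \<noteq> y"
  using pair_loopfree_digraph.pair_no_loops[OF loopfree edge] by simp

lemma conn: "m \<in> connections G"
  by (rule moduli_connections[OF A m])

sublocale words_in_one_variable "{(y, x)}" "{(x, y)}" "adjoint_conn m"
  by unfold_locales (use neq in auto)

lemma unitary_edge: "m (x, y) \<in> unitary_group"
  by (rule connection_unitary[OF conn edge])

lemma val_edge: "val (m (x, y)) = adjoint_conn m"
  using connection_reverse[OF conn edge edge'] by (auto simp: val_def adjoint_conn_def fun_eq_iff)

lemma class_trace_closed:
  "closed_in G \<xi> \<Longrightarrow> class_trace (holonomy A (loop_of \<xi>)) = cnj (wt (m (x, y)) (loop_arcs \<xi>))"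
  using class_trace_holonomy_moduli[OF A m wf] by (simp add: val_edge)

lemma closed: "a < length bs \<Longrightarrow> closed_in G (bs ! a)"
  using based[of "bs ! a"] by (simp add: based_loops_iff)

abbreviation ws :: "('v \<times> 'v) list list" where
  "ws \<equiv> map loop_arcs bs"

lemma tau_subcollection:
  assumes "C \<subseteq> {..<length bs}"
  shows "(\<Prod>l\<in>#subcollection bs C. class_trace (holonomy A l)) = cnj (\<Prod>c\<in>C. wt (m (x, y)) (ws ! c))"
proof -
  have "class_trace (holonomy A (loop_of (bs ! c))) = cnj (wt (m (x, y)) (ws ! c))" if "c \<in> C" for c
    using assms that closed[of c] class_trace_closed[of "bs ! c"] by auto
  then show ?thesis by (simp add: prod_subcollection)
qed

definition crossed :: "'v \<times> 'v \<Rightarrow> (nat \<times> nat) set" where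
  "crossed e = crossing_indices (fst e) (snd e) bs"

lemma crossedD:
  assumes "(a, i) \<in> crossed e"
  shows "a < length bs" "i < length (bs ! a)" "loop_arcs (bs ! a) ! i = e"
  using assms by (auto simp: crossed_def crossing_indices_def nth_loop_arcs)

text \<open>Two crossings in the same direction start at a common vertex and end at a common vertex, so the
  pieces are closed walks whether they are cut before or behind the crossings.\<close>

lemma joint_same:
  assumes e: "e \<in> {(x, y), (y, x)}" and s: "s \<in> crossed e" and t: "t \<in> crossed e" and "s \<noteq> t"
  shows "cnj (joint (m (x, y)) ws s t) = tau A (split_merge bs s t)"
proof -
  obtain a i b j where st: "s = (a, i)" "t = (b, j)" by (cases s; cases t)
  note a = crossedD[OF s[unfolded st]] and b = crossedD[OF t[unfolded st]]
  have vertex: "bs ! a ! i = bs ! b ! j"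
    using a b by (metis fst_conv nth_loop_arcs)
  show ?thesis
  proof (cases "a = b")
    case True
    define k where "k = (j + length (bs ! a) - i) mod length (bs ! a)"
    define \<xi> where "\<xi> = rotate i (bs ! a)"
    have ij: "i \<noteq> j" using assms(4) st True by auto
    note off = rotate_offset[OF a(2) b(2)[folded True] ij, folded k_def \<xi>_def]
    have "loop_arcs \<xi> ! 0 = e" "loop_arcs \<xi> ! k = e"
      using rotate_offset(3,4)[of i "loop_arcs (bs ! a)" j] a b True ij
      by (simp_all add: \<xi>_def k_def loop_arcs_rotate)
    moreover have arcs: "loop_arcs (take k \<xi>) = take k (loop_arcs \<xi>)" "loop_arcs (drop k \<xi>) = drop k (loop_arcs \<xi>)"
      by (rule loop_arcs_take_drop; use off vertex True in \<open>simp add: \<xi>_def\<close>)+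
    have cl: "closed_in G \<xi>" using closed[OF a(1)] by (simp add: \<xi>_def)
    then have "closed_in G (take k \<xi>)" "closed_in G (drop k \<xi>)"
      unfolding closed_in_def arcs by (meson order_trans set_take_subset set_drop_subset)+
    moreover have "split_merge bs s t = add_mset (loop_of (take k \<xi>)) (add_mset (loop_of (drop k \<xi>))
        (subcollection bs ({..<length bs} - {a})))"
      using a b ij True by (simp add: st split_merge_eq \<xi>_def k_def)
    ultimately have "tau A (split_merge bs s t) = cnj (wt (m (x, y)) (take k (loop_arcs \<xi>)) *
        wt (m (x, y)) (drop k (loop_arcs \<xi>)) * (\<Prod>c\<in>{..<length bs} - {a}. wt (m (x, y)) (ws ! c)))"
      by (simp add: tau_nonempty class_trace_closed tau_subcollection arcs mult.assoc)
    then show ?thesis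
      using True a(1) \<open>loop_arcs \<xi> ! 0 = e\<close> \<open>loop_arcs \<xi> ! k = e\<close>
      by (simp add: st joint_def split_term_def same_kind_def \<xi>_def k_def loop_arcs_rotate)
  next
    case False
    define \<xi> \<eta> where "\<xi> = rotate i (bs ! a)" and "\<eta> = rotate j (bs ! b)"
    have ne: "\<xi> \<noteq> []" "\<eta> \<noteq> []" using a b by (auto simp: \<xi>_def \<eta>_def)
    have hds: "hd (loop_arcs \<xi>) = e" "hd (loop_arcs \<eta>) = e"
      using a b by (simp_all add: \<xi>_def \<eta>_def loop_arcs_rotate hd_rotate)
    have arcs: "loop_arcs (\<xi> @ \<eta>) = loop_arcs \<xi> @ loop_arcs \<eta>"
      using ne a b vertex by (intro loop_arcs_append) (simp_all add: \<xi>_def \<eta>_def hd_rotate)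
    have "closed_in G (\<xi> @ \<eta>)"
      using closed[OF a(1)] closed[OF b(1)] unfolding closed_in_def arcs
      by (simp add: \<xi>_def \<eta>_def loop_arcs_rotate)
    moreover have "split_merge bs s t = add_mset (loop_of (\<xi> @ \<eta>)) (subcollection bs ({..<length bs} - {a} - {b}))"
      using a b False by (simp add: st split_merge_eq \<xi>_def \<eta>_def)
    ultimately have "tau A (split_merge bs s t) = cnj (wt (m (x, y)) (loop_arcs \<xi> @ loop_arcs \<eta>) *
        (\<Prod>c\<in>{..<length bs} - {a} - {b}. wt (m (x, y)) (ws ! c)))"
      using tau_subcollection[of "{..<length bs} - {a} - {b}", OF subset_trans[OF Diff_subset Diff_subset]]
      by (simp add: tau_nonempty class_trace_closed arcs)
    then show ?thesis
      using False a(1) b(1) hds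
      by (simp add: st joint_def merge_term_def same_kind_def \<xi>_def \<eta>_def loop_arcs_rotate)
  qed
qed

text \<open>Two crossings in opposite directions are erased. A merged loop is reduced, which does not change its
  trace. If it is reduced to the trivial loop and is the only one, the outcome is the empty collection,
  whose value \<open>d\<close> is the trace of the empty word.\<close>

lemma joint_opposite:
  assumes pq: "(p, q) \<in> {(x, y), (y, x)}" and s: "s \<in> crossed (p, q)" and t: "t \<in> crossed (q, p)"
  shows "cnj (joint (m (x, y)) ws s t) = tau A (neg_split_merge bs s t)"
proof -
  obtain a i b j where st: "s = (a, i)" "t = (b, j)" by (cases s; cases t)
  note a = crossedD[OF s[unfolded st]] and b = crossedD[OF t[unfolded st]]
  have pq': "p \<noteq> q" using pq neq by auto
  have kinds: "\<not> same_kind (p, q) (q, p)" using pq neq by (auto simp: same_kind_def)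
  show ?thesis
  proof (cases "a = b")
    case True
    define k where "k = (j + length (bs ! a) - i) mod length (bs ! a)"
    define \<xi> where "\<xi> = rotate i (bs ! a)"
    have ij: "i \<noteq> j" using a b True pq' by auto
    note off = rotate_offset[OF a(2) b(2)[folded True] ij, folded k_def \<xi>_def]
    have ends: "loop_arcs \<xi> ! 0 = (p, q)" "loop_arcs \<xi> ! k = (q, p)"
      using rotate_offset(3,4)[of i "loop_arcs (bs ! a)" j] a b True ij
      by (simp_all add: \<xi>_def k_def loop_arcs_rotate)
    have k: "0 < k" "k < length \<xi>" using off by (simp_all add: \<xi>_def)
    note arcs = loop_arcs_erase[OF k ends]
    have cl: "closed_in G \<xi>" using closed[OF a(1)] by (simp add: \<xi>_def)
    have "set (take (k - 1) (tl (loop_arcs \<xi>))) \<subseteq> set (loop_arcs \<xi>)"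
      by (cases "loop_arcs \<xi>") (auto dest: in_set_takeD)
    with cl have "closed_in G (take (k - 1) (tl \<xi>))" "closed_in G (drop (k + 1) \<xi>)"
      unfolding closed_in_def arcs by (meson order_trans set_drop_subset)+
    moreover have "neg_split_merge bs s t = add_mset (loop_of (take (k - 1) (tl \<xi>)))
        (add_mset (loop_of (drop (k + 1) \<xi>)) (subcollection bs ({..<length bs} - {a})))"
      using a b True by (simp add: st neg_split_merge_eq \<xi>_def k_def)
    ultimately have "tau A (neg_split_merge bs s t) = cnj (wt (m (x, y)) (take (k - 1) (tl (loop_arcs \<xi>))) *
        wt (m (x, y)) (drop (k + 1) (loop_arcs \<xi>)) * (\<Prod>c\<in>{..<length bs} - {a}. wt (m (x, y)) (ws ! c)))"
      by (simp only: tau_nonempty add_mset_not_empty not_False_eq_True image_mset_add_mset prod_mset.add_mset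
          class_trace_closed tau_subcollection[OF Diff_subset] arcs complex_cnj_mult mult.assoc)
    then show ?thesis
      using True a(1) ends kinds
      by (simp add: st joint_def split_term_def \<xi>_def k_def loop_arcs_rotate)
  next
    case False
    define \<xi> \<eta> where "\<xi> = rotate i (bs ! a)" and "\<eta> = rotate j (bs ! b)"
    define rest where "rest = subcollection bs ({..<length bs} - {a} - {b})"
    have ne: "\<xi> \<noteq> []" "\<eta> \<noteq> []" using a b by (auto simp: \<xi>_def \<eta>_def)
    have hds: "hd (loop_arcs \<xi>) = (p, q)" "hd (loop_arcs \<eta>) = (q, p)"
      using a b by (simp_all add: \<xi>_def \<eta>_def loop_arcs_rotate hd_rotate)
    have "loop_arcs \<xi> ! 0 = (p, q)" "loop_arcs \<eta> ! 0 = (q, p)"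
      using hds ne by (metis hd_conv_nth length_0_conv length_loop_arcs)+
    then have arcs: "loop_arcs (tl \<xi> @ tl \<eta>) = tl (loop_arcs \<xi>) @ tl (loop_arcs \<eta>)"
      by (rule loop_arcs_merge[OF pq' ne])
    have "set (tl (loop_arcs \<xi>)) \<subseteq> set (loop_arcs \<xi>)" "set (tl (loop_arcs \<eta>)) \<subseteq> set (loop_arcs \<eta>)"
      by (cases "loop_arcs \<xi>", auto) (cases "loop_arcs \<eta>", auto)
    then have "closed_in G (tl \<xi> @ tl \<eta>)"
      using closed[OF a(1)] closed[OF b(1)] unfolding closed_in_def arcs
      by (auto simp: \<xi>_def \<eta>_def loop_arcs_rotate)
    moreover have "adjoint_conn m (v, w) ** adjoint_conn m (w, v) = mat 1"
      if "(v, w) \<in> parcs G" "(w, v) \<in> parcs G" for v w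
      using connection_reverse[OF conn that] unitary_cancel[OF connection_unitary[OF conn that(2)]]
      by (simp add: adjoint_conn_def)
    ultimately obtain \<zeta> where \<zeta>: "reduced (loop_of (tl \<xi> @ tl \<eta>)) = loop_of \<zeta>" "closed_in G \<zeta>"
      and eq: "wt (m (x, y)) (loop_arcs \<zeta>) = wt (m (x, y)) (loop_arcs (tl \<xi> @ tl \<eta>))"
      using reduced_invariant[OF loopfree, of "tl \<xi> @ tl \<eta>" "adjoint_conn m"] unfolding val_edge by blast
    have "tau A (neg_split_merge bs s t) = (\<Prod>l\<in>#add_mset (loop_of \<zeta>) rest. class_trace (holonomy A l))"
    proof (cases "loop_of \<zeta> = trivial_loop \<and> rest = {#}")
      case True
      have "class_trace (holonomy A trivial_loop) = of_nat CARD('d)"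
        using class_trace_closed[of "[]"] by (simp add: closed_in_def trivial_loop_def)
      moreover have "neg_split_merge bs s t = {#}"
        using a b False True by (simp add: st neg_split_merge_eq \<zeta>(1)[unfolded \<xi>_def \<eta>_def] rest_def)
      ultimately show ?thesis using True by (simp add: tau_def)
    next
      case nontrivial: False
      have "neg_split_merge bs s t = add_mset (loop_of \<zeta>) rest"
        using a b False nontrivial
        by (simp add: st neg_split_merge_eq \<zeta>(1)[unfolded \<xi>_def \<eta>_def] rest_def)
      then show ?thesis by (simp add: tau_nonempty)
    qed
    also have "\<dots> = cnj (wt (m (x, y)) (tl (loop_arcs \<xi>) @ tl (loop_arcs \<eta>)) *
        (\<Prod>c\<in>{..<length bs} - {a} - {b}. wt (m (x, y)) (ws ! c)))"
      using tau_subcollection[of "{..<length bs} - {a} - {b}", OF subset_trans[OF Diff_subset Diff_subset]] \<zeta>(2) eq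
      by (simp add: class_trace_closed arcs rest_def)
    finally show ?thesis
      using False a(1) b(1) hds kinds
      by (simp add: st joint_def merge_term_def \<xi>_def \<eta>_def loop_arcs_rotate)
  qed
qed

lemma active_edge: "active ws = crossed (x, y) \<union> crossed (y, x)"
  by (auto simp: active_def crossed_def crossing_indices_def nth_loop_arcs)

lemma crossed_disjoint: "crossed (x, y) \<inter> crossed (y, x) = {}"
  using neq by (auto simp: crossed_def crossing_indices_def)

lemma sign_at_crossed:
  "s \<in> crossed (x, y) \<Longrightarrow> sign_at ws s = -1" "s \<in> crossed (y, x) \<Longrightarrow> sign_at ws s = 1"
  using neq crossedD[of "fst s" "snd s"] by (auto simp: sign_at_def sign_def split_def)

lemma finite_crossed [simp]: "finite (crossed e)"
  by (simp add: crossed_def)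

lemma words_trace_edge:
  assumes "bs \<noteq> []"
  shows "cnj (words_trace ws (m (x, y))) = tau A (mset (map loop_of bs))"
  using assms tau_subcollection[of "{..<length bs}"]
  by (simp add: tau_nonempty words_trace_def flip: subcollection_all)

text \<open>The sum over pairs of active letters falls into the four blocks of directions; the sign of a block
  is positive for equal and negative for opposite directions.\<close>

lemma contractions_edge:
  assumes "bs \<noteq> []"
  defines "D \<equiv> \<lambda>e. \<Sum>s\<in>crossed e. \<Sum>t\<in>crossed e - {s}. tau A (split_merge bs s t)"
    and "M \<equiv> \<lambda>e e'. \<Sum>s\<in>crossed e. \<Sum>t\<in>crossed e'. tau A (neg_split_merge bs s t)"
  shows "cnj (contractions ws (m (x, y))) =
    of_nat CARD('d) * of_nat (card (crossed (x, y)) + card (crossed (y, x))) * tau A (mset (map loop_of bs))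
    + D (x, y) + D (y, x) - M (x, y) (y, x) - M (y, x) (x, y)"
proof -
  let ?X = "crossed (x, y)" and ?Y = "crossed (y, x)"
  let ?J = "\<lambda>s t. (sign_at ws s * sign_at ws t) *\<^sub>R cnj (joint (m (x, y)) ws s t)"
  have row: "(\<Sum>t\<in>active ws - {s}. ?J s t) = (\<Sum>t\<in>crossed (p, q) - {s}. tau A (split_merge bs s t))
      - (\<Sum>t\<in>crossed (q, p). tau A (neg_split_merge bs s t))"
    if pq: "(p, q) \<in> {(x, y), (y, x)}" and s: "s \<in> crossed (p, q)" for s p q
  proof -
    have "active ws - {s} = (crossed (p, q) - {s}) \<union> crossed (q, p)"
      using pq s crossed_disjoint unfolding active_edge by auto
    moreover have "(crossed (p, q) - {s}) \<inter> crossed (q, p) = {}"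
      using pq crossed_disjoint by auto
    ultimately have "(\<Sum>t\<in>active ws - {s}. ?J s t)
        = (\<Sum>t\<in>crossed (p, q) - {s}. ?J s t) + (\<Sum>t\<in>crossed (q, p). ?J s t)"
      by (simp add: sum.union_disjoint)
    also have "(\<Sum>t\<in>crossed (p, q) - {s}. ?J s t) = (\<Sum>t\<in>crossed (p, q) - {s}. tau A (split_merge bs s t))"
    proof (intro sum.cong refl)
      fix t assume t: "t \<in> crossed (p, q) - {s}"
      then have "sign_at ws s * sign_at ws t = 1" using pq s t sign_at_crossed[of s] sign_at_crossed[of t] by auto
      then show "?J s t = tau A (split_merge bs s t)"
        using joint_same[OF pq s, of t] t by auto
    qed
    also have "(\<Sum>t\<in>crossed (q, p). ?J s t) = (\<Sum>t\<in>crossed (q, p). - tau A (neg_split_merge bs s t))"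
    proof (intro sum.cong refl)
      fix t assume t: "t \<in> crossed (q, p)"
      then have "sign_at ws s * sign_at ws t = -1" using pq s t sign_at_crossed[of s] sign_at_crossed[of t] by auto
      then show "?J s t = - tau A (neg_split_merge bs s t)"
        using joint_opposite[OF pq s t] by simp
    qed
    finally show ?thesis by (simp add: sum_negf)
  qed
  have "(\<Sum>s\<in>active ws. \<Sum>t\<in>active ws - {s}. ?J s t)
      = (\<Sum>s\<in>?X. \<Sum>t\<in>active ws - {s}. ?J s t) + (\<Sum>s\<in>?Y. \<Sum>t\<in>active ws - {s}. ?J s t)"
    unfolding active_edge by (rule sum.union_disjoint) (use crossed_disjoint in auto)
  also have "\<dots> = D (x, y) - M (x, y) (y, x) + (D (y, x) - M (y, x) (x, y))"
    unfolding D_def M_def sum_subtractf[symmetric]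
    by (intro arg_cong2[of _ _ _ _ "(+)"] sum.cong refl row) auto
  finally have "(\<Sum>s\<in>active ws. \<Sum>t\<in>active ws - {s}. ?J s t)
      = D (x, y) - M (x, y) (y, x) + (D (y, x) - M (y, x) (x, y))" .
  moreover have "card (active ws) = card ?X + card ?Y"
    unfolding active_edge by (rule card_Un_disjoint) (use crossed_disjoint in auto)
  ultimately show ?thesis
    using words_trace_edge[OF assms(1)] by (simp add: contractions_def)
qed

end

lemma casimir_const:
  fixes g :: "complex^'d^'d"
  assumes "orthonormal_basis_antiherm B" "g \<in> unitary_group"
  shows "casimir B (\<lambda>_. c) g = 0"
proof -
  have "has_lie_deriv W (\<lambda>_. c') (\<lambda>_. 0)" for c' :: complex and W :: "complex^'d^'d"
    by (simp add: has_lie_deriv_def)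
  then have "casimir B (\<lambda>_. c) g = (\<Sum>W\<in>B. 0)"
    by (intro casimir_eqI[where ?f1.0 = "\<lambda>_ _. 0" and ?f2.0 = "\<lambda>_ _. 0", OF assms])
  then show ?thesis by simp
qed

lemma orientation_cases:
  assumes "orientation G Or" "(p, q) \<in> parcs G" "(q, p) \<in> parcs G"
  obtains "(p, q) \<in> Or" "(q, p) \<notin> Or" | "(p, q) \<notin> Or" "(q, p) \<in> Or"
  using assms by (auto simp: orientation_def)

text \<open>Moving one coordinate of \<open>U(d)\<^sup>E\<close> inside the unitary group gives another connection, whose
  adjoint has exactly the letters of the words in that coordinate.\<close>

lemma conn_of_update:
  fixes m :: "'v \<times> 'v \<Rightarrow> complex^'d^'d"
  assumes G: "pair_graph G" and Or: "orientation G Or" and m: "m \<in> connections G"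
    and e: "(x, y) \<in> Or" and g: "g \<in> unitary_group"
  defines "m' \<equiv> conn_of Or ((restrict m Or)((x, y) := g))"
  shows "m' \<in> connections G"
    and "f \<in> parcs G \<Longrightarrow> adjoint_conn m' f = (if f \<in> {(y, x)} then g else if f \<in> {(x, y)} then cadj g
      else adjoint_conn m f)"
proof -
  have sub: "Or \<subseteq> parcs G" using Or by (simp add: orientation_def)
  have xy: "(x, y) \<in> parcs G" "(y, x) \<in> parcs G" "(y, x) \<notin> Or"
    using e sub symmetric_arcs[OF G] Or by (auto simp: orientation_def)
  then have neq: "x \<noteq> y" using e by auto
  have val: "m' (p, q) = (if (p, q) = (x, y) then g else if (p, q) = (y, x) then cadj g else m (p, q))"
    if pq: "(p, q) \<in> parcs G" for p q
  proof -
    note qp = symmetric_arcs[OF G pq]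
    show ?thesis
    proof (cases rule: orientation_cases[OF Or pq qp])
      case 1
      then have "m' (p, q) = ((restrict m Or)((x, y) := g)) (p, q)"
        by (simp add: m'_def conn_of_def)
      moreover have "(p, q) \<noteq> (y, x)" using 1 xy(3) by auto
      ultimately show ?thesis using 1(1) by (simp only: fun_upd_apply restrict_apply' if_False refl)
    next
      case 2
      then have m'_eq: "m' (p, q) = matrix_inv (((restrict m Or)((x, y) := g)) (q, p))"
        by (simp add: m'_def conn_of_def)
      have "(p, q) \<noteq> (x, y)" using 2 e by auto
      moreover have "matrix_inv (m (q, p)) = m (p, q)"
        using connection_reverse[OF m pq qp] matrix_inv_unitary[OF connection_unitary[OF m qp]] by simp
      moreover have "(q, p) = (x, y) \<longleftrightarrow> (p, q) = (y, x)" by auto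
      ultimately show ?thesis
        using 2(2) matrix_inv_unitary[OF g] unfolding m'_eq
        by (simp only: fun_upd_apply restrict_apply' if_False refl split: if_split) blast
    qed
  qed
  have unitary: "m' (p, q) \<in> unitary_group" if "(p, q) \<in> parcs G" for p q
    using val[OF that] g connection_unitary[OF m that] by (simp add: unitary_cadj)
  have "m' (p, q) = matrix_inv (m' (q, p))" if pq: "(p, q) \<in> parcs G" for p q
  proof -
    note qp = symmetric_arcs[OF G pq]
    have "m' (p, q) = cadj (m' (q, p))"
      using val[OF pq] val[OF qp] connection_reverse[OF m pq qp] neq by auto
    then show ?thesis using unitary[OF qp] by (simp add: matrix_inv_unitary)
  qed
  moreover have "m' (p, q) = undefined" if "(p, q) \<notin> parcs G" for p q
  proof -
    have "(p, q) \<notin> Or" "(q, p) \<notin> Or"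
      using that sub symmetric_arcs[OF G, of q p] by blast+
    then show ?thesis by (simp add: m'_def conn_of_def)
  qed
  ultimately show "m' \<in> connections G"
    using unitary unfolding connections_def by (intro CollectI conjI PiE_I) auto
  show "adjoint_conn m' f = (if f \<in> {(y, x)} then g else if f \<in> {(x, y)} then cadj g
      else adjoint_conn m f)" if "f \<in> parcs G"
  proof -
    obtain p q where f: "f = (p, q)" by (cases f)
    have "(x, y) \<noteq> (y, x)" using neq by simp
    then show ?thesis
      using val[of p q] that unfolding f adjoint_conn_def
      by (simp del: prod.inject)
  qed
qed

lemma geodesic_loops_subset: "geodesic_loops G \<subseteq> loops G"
  by (auto simp: geodesic_loops_def loops_def)

text \<open>The empty collection is treated separately: the function is then constant by convention, and no edge
  is crossed.\<close>

lemma casimir_coord_tau: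
  fixes m :: "'v \<times> 'v \<Rightarrow> complex^'d^'d" and L :: "'v collection"
  assumes G: "pair_graph G" and B: "orthonormal_basis_antiherm B" and Or: "orientation G Or"
    and A: "A \<in> moduli G" "m \<in> A" and L: "set_mset L \<subseteq> loops G" and e: "(x, y) \<in> Or"
  defines "I \<equiv> \<lambda>x y. crossing_indices x y (listing L)"
  defines "D \<equiv> \<lambda>x y. \<Sum>s\<in>I x y. \<Sum>t\<in>I x y - {s}. tau A (split_merge (listing L) s t)"
    and "M \<equiv> \<lambda>x y. \<Sum>s\<in>I x y. \<Sum>t\<in>I y x. tau A (neg_split_merge (listing L) s t)"
  shows "casimir_coord B (x, y) (\<lambda>u. tau (modulus G (conn_of Or u)) L) (restrict m Or)
    = - (of_nat CARD('d) * of_nat (card (I x y) + card (I y x)) * tau A L + D x y + D y x - M x y - M y x)"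
proof (cases "L = {#}")
  case True
  then have "listing L = []" by (simp flip: mset_zero_iff add: mset_listing)
  then have I: "I x y = {}" for x y by (simp add: I_def crossing_indices_def)
  have "m (x, y) \<in> unitary_group"
    using connection_unitary[OF moduli_connections[OF A]] e Or by (auto simp: orientation_def)
  from casimir_const[OF B this] True e show ?thesis
    by (simp add: casimir_coord_def tau_def D_def M_def I)
next
  case False
  have xy: "(x, y) \<in> parcs G" using e Or by (auto simp: orientation_def)
  interpret edge_variable G A m x y "listing L"
    by (rule edge_variable.intro[OF G A xy listing_based_loops[OF L]])
  have bs: "mset (map loop_of (listing L)) = L" by (rule mset_loop_of_listing[OF L])
  have ne: "listing L \<noteq> []" using bs False by auto
  have "tau (modulus G (conn_of Or ((restrict m Or)((x, y) := g)))) L = cnj (words_trace ws g)"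
    if g: "g \<in> unitary_group" for g
  proof -
    define m' where "m' = conn_of Or ((restrict m Or)((x, y) := g))"
    note m' = conn_of_update[OF G Or conn e g, folded m'_def]
    have mod: "modulus G m' \<in> moduli G" "m' \<in> modulus G m'"
      using modulus_in_moduli[OF m'(1)] gauge_equiv_refl[OF m'(1) wf] by (auto simp: modulus_def)
    have "class_trace (holonomy (modulus G m') (loop_of (listing L ! c))) = cnj (wt g (ws ! c))"
      if c: "c < length (listing L)" for c
    proof -
      have "map (adjoint_conn m') (loop_arcs (listing L ! c)) = map (val g) (loop_arcs (listing L ! c))"
      proof (intro map_cong refl)
        fix f assume "f \<in> set (loop_arcs (listing L ! c))"
        then have "f \<in> parcs G" using closed[OF c] unfolding closed_in_def by blast
        then show "adjoint_conn m' f = val g f"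
          unfolding val_def by (rule m'(2))
      qed
      then have "word_trace (adjoint_conn m') (loop_arcs (listing L ! c)) = wt g (loop_arcs (listing L ! c))"
        by (simp only: word_trace_def)
      then show ?thesis
        using class_trace_holonomy_moduli[OF mod wf closed[OF c]] c by simp
    qed
    then have "(\<Prod>l\<in>#subcollection (listing L) {..<length (listing L)}. class_trace (holonomy (modulus G m') l))
        = cnj (words_trace ws g)"
      by (simp add: prod_subcollection words_trace_def)
    then show ?thesis
      using False unfolding m'_def[symmetric] subcollection_all[symmetric] bs by (simp add: tau_nonempty)
  qed
  then have "casimir_coord B (x, y) (\<lambda>u. tau (modulus G (conn_of Or u)) L) (restrict m Or)
      = casimir B (\<lambda>g. cnj (words_trace ws g)) (m (x, y))"
    unfolding casimir_coord_def restrict_apply'[OF e] by (rule casimir_cong[OF B unitary_edge])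
  also have "\<dots> = - cnj (contractions ws (m (x, y)))"
    by (rule casimir_words_trace(2)[OF B unitary_edge])
  finally show ?thesis
    unfolding contractions_edge[OF ne] bs by (simp add: crossed_def I_def D_def M_def)
qed

section \<open>Sums over edges\<close>

lemma sum_parcs_orientation:
  fixes f :: "'v \<Rightarrow> 'v \<Rightarrow> 'b::comm_monoid_add"
  assumes G: "pair_graph G" and Or: "orientation G Or"
  shows "(\<Sum>(x, y)\<in>parcs G. f x y) = (\<Sum>(x, y)\<in>Or. f x y + f y x)"
proof -
  have fin: "finite (parcs G)"
    using G by (simp add: pair_graph_def pair_digraph_def pair_fin_digraph_def pair_fin_digraph_axioms_def)
  have sub: "Or \<subseteq> parcs G" using Or by (simp add: orientation_def)
  have parcs: "parcs G = Or \<union> prod.swap ` Or"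
  proof (intro equalityI subsetI)
    fix e assume e: "e \<in> parcs G"
    obtain p q where pq: "e = (p, q)" by (cases e)
    then have "(p, q) \<in> parcs G" "(q, p) \<in> parcs G" using e symmetric_arcs[OF G] by auto
    then show "e \<in> Or \<union> prod.swap ` Or"
      using orientation_cases[OF Or] image_eqI[of e prod.swap "(q, p)" Or] by (simp add: pq) blast
  qed (use sub symmetric_arcs[OF G] in auto)
  have "(q, p) \<notin> Or" if "(p, q) \<in> Or" for p q
    using Or that by (auto simp: orientation_def)
  then have "Or \<inter> prod.swap ` Or = {}"
    by auto
  then have "(\<Sum>(x, y)\<in>parcs G. f x y) = (\<Sum>(x, y)\<in>Or. f x y) + (\<Sum>(x, y)\<in>prod.swap ` Or. f x y)"
    unfolding parcs using finite_subset[OF sub fin] by (intro sum.union_disjoint) auto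
  also have "(\<Sum>(x, y)\<in>prod.swap ` Or. f x y) = (\<Sum>(x, y)\<in>Or. f y x)"
    by (subst sum.reindex) (auto simp: split_def)
  finally show ?thesis
    by (simp add: sum.distrib split_def)
qed

text \<open>Each loop follows arcs of the graph only, so pairs of vertices that are no arcs contribute nothing.\<close>

lemma S_occ_orientation:
  assumes G: "pair_graph G" and Or: "orientation G Or" and L: "set_mset L \<subseteq> loops G"
  shows "S_occ G L = (\<Sum>(x, y)\<in>Or. N_edge x y L + N_edge y x L)"
proof -
  have "S_occ G L = (\<Sum>(x, y)\<in>pverts G \<times> pverts G. N_edge x y L)"
    by (simp add: S_occ_def N_vert_sum sum.cartesian_product)
  also have "\<dots> = (\<Sum>(x, y)\<in>parcs G. N_edge x y L)"
  proof (rule sum.mono_neutral_right)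
    show "finite (pverts G \<times> pverts G)"
      using G by (simp add: pair_graph_def pair_digraph_def pair_fin_digraph_def pair_fin_digraph_axioms_def)
    have "pair_wf_digraph G"
      using G by (simp add: pair_graph_def pair_digraph_def pair_fin_digraph_def)
    then show "parcs G \<subseteq> pverts G \<times> pverts G"
      using pair_wf_digraph.arc_fst_in_verts pair_wf_digraph.arc_snd_in_verts by (fastforce simp: mem_Times_iff)
    have "crossing_indices x y (listing L) = {}" if "(x, y) \<notin> parcs G" for x y
      using that listing_based_loops[OF L] by (auto simp: crossing_indices_def based_loops_def)
    then show "\<forall>e\<in>pverts G \<times> pverts G - parcs G. (case e of (x, y) \<Rightarrow> N_edge x y L) = 0"
      by (auto simp: N_edge_card)
  qed
  finally show ?thesis by (simp add: sum_parcs_orientation[OF G Or])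
qed

text \<open>Edge by edge. The pairs of equal indices in the rates of both orientations account for the difference
  of \<open>d\<close> and \<open>d - 1\<close>, as at a vertex. The pairs of opposite crossings form two blocks, one for
  each of the two orientations of the edge in \<open>B\<^sup>S\<^sup>M\<^sup>-\<close>.\<close>

theorem casimir_conn_tau:
  fixes m :: "'v \<times> 'v \<Rightarrow> complex^'d^'d"
  assumes G: "pair_graph G" and B: "orthonormal_basis_antiherm B" and Or: "orientation G Or"
    and A: "A \<in> moduli G" "m \<in> A" and L: "set_mset L \<subseteq> loops G"
  shows "casimir_conn Or B (\<lambda>m'. tau (modulus G m') L) m =
    - ((of_nat CARD('d) - 1) * of_nat (S_occ G L) * tau A L
       + of_nat (Vplus Or L) * tau A L - of_nat (Vminus Or L) * tau A L
       + B_SM_plus G (tau A) L - B_SM_minus G (tau A) L)"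
proof -
  let ?d = "of_nat CARD('d) :: complex" and ?\<tau> = "tau A L" and ?bs = "listing L"
  let ?I = "\<lambda>x y. crossing_indices x y ?bs"
  let ?N = "\<lambda>x y. of_nat (N_edge x y L) :: complex"
  define D where "D = (\<lambda>x y. \<Sum>s\<in>?I x y. \<Sum>t\<in>?I x y - {s}. tau A (split_merge ?bs s t))"
  define M where "M = (\<lambda>x y. \<Sum>s\<in>?I x y. \<Sum>t\<in>?I y x. tau A (neg_split_merge ?bs s t))"
  define P where "P = (\<lambda>x y. of_nat ((N_edge x y L)\<^sup>2) * (kernel_act (Kplus_kernel x y) (tau A) L - ?\<tau>))"
  define Q where "Q = (\<lambda>x y. of_nat (N_edge x y L * N_edge y x L) *
    (kernel_act (Kminus_kernel x y) (tau A) L - ?\<tau>))"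
  have P: "P x y = ?N x y * ?\<tau> + D x y - ?N x y * ?N x y * ?\<tau>" for x y
  proof -
    have "P x y = of_nat (card (?I x y)) * ?\<tau> + D x y - of_nat ((card (?I x y))\<^sup>2) * ?\<tau>"
      unfolding P_def D_def N_edge_card
      by (rule kernel_act_self)
         (simp_all add: Kplus_kernel_def Let_def split_merge_self mset_loop_of_listing[OF L] del: mset_map)
    then show ?thesis by (simp add: N_edge_card power2_eq_square)
  qed
  have Q: "Q x y = M x y - ?N x y * ?N y x * ?\<tau>" for x y
    using kernel_act_pair[of "?I x y" "?I y x" "Kminus_kernel x y" L "neg_split_merge ?bs" "tau A"]
    by (simp add: Q_def M_def N_edge_card Kminus_kernel_def Let_def right_diff_distrib)
  have edge: "casimir_coord B (x, y) (\<lambda>u. tau (modulus G (conn_of Or u)) L) (restrict m Or)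
      = - ((?d - 1) * of_nat (N_edge x y L + N_edge y x L) * ?\<tau>
           + of_nat ((N_edge x y L)\<^sup>2 + (N_edge y x L)\<^sup>2) * ?\<tau>
           - of_nat (2 * (N_edge x y L * N_edge y x L)) * ?\<tau> + (P x y + P y x) - (Q x y + Q y x))"
    if "(x, y) \<in> Or" for x y
    unfolding casimir_coord_tau[OF G B Or A L that] P Q D_def M_def N_edge_card
    by (simp add: algebra_simps power2_eq_square)
  have "casimir_conn Or B (\<lambda>m'. tau (modulus G m') L) m
      = (\<Sum>(x, y)\<in>Or. - ((?d - 1) * of_nat (N_edge x y L + N_edge y x L) * ?\<tau>
           + of_nat ((N_edge x y L)\<^sup>2 + (N_edge y x L)\<^sup>2) * ?\<tau>
           - of_nat (2 * (N_edge x y L * N_edge y x L)) * ?\<tau> + (P x y + P y x) - (Q x y + Q y x)))"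
    unfolding casimir_conn_def by (intro sum.cong refl) (auto simp only: edge split: prod.splits)
  also have "\<dots> = - ((?d - 1) * of_nat (S_occ G L) * ?\<tau>
       + of_nat (Vplus Or L) * ?\<tau> - of_nat (Vminus Or L) * ?\<tau>
       + (\<Sum>(x, y)\<in>Or. P x y + P y x) - (\<Sum>(x, y)\<in>Or. Q x y + Q y x))"
    unfolding S_occ_orientation[OF G Or L] Vplus_def Vminus_def sum_distrib_left split_def of_nat_sum
    by (simp only: sum_negf sum.distrib sum_subtractf sum_distrib_left sum_distrib_right)
  also have "(\<Sum>(x, y)\<in>Or. P x y + P y x) = B_SM_plus G (tau A) L"
    unfolding B_SM_plus_def P_def by (rule sum_parcs_orientation[OF G Or, symmetric])
  also have "(\<Sum>(x, y)\<in>Or. Q x y + Q y x) = B_SM_minus G (tau A) L"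
    unfolding B_SM_minus_def Q_def by (rule sum_parcs_orientation[OF G Or, symmetric])
  finally show ?thesis .
qed

lemma flow_no_opposite_crossings:
  assumes "orientation G Or" "flow G L"
  shows "Vminus Or L = 0" "B_SM_minus G F L = 0"
proof -
  have flow: "N_edge x y L * N_edge y x L = 0" if "(x, y) \<in> parcs G" for x y
    using assms(2) that unfolding flow_def by fast
  have "N_edge x y L * N_edge y x L = 0" if "(x, y) \<in> Or" for x y
    using flow[of x y] assms(1) that by (auto simp: orientation_def)
  then show "Vminus Or L = 0"
    unfolding Vminus_def by (subst sum.neutral) auto
  show "B_SM_minus G F L = 0"
    unfolding B_SM_minus_def by (rule sum.neutral) (auto simp only: flow split: prod.splits, simp)
qed

theorem theorem5p1:
  fixes G :: "'v pair_pre_digraph"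
    and B :: "(complex^'d^'d) set"
    and Or :: "('v \<times> 'v) set"
  assumes "pair_graph G" and "Digraph_Component.connected (with_proj G)"
    and "orthonormal_basis_antiherm B"
    and "orientation G Or"
  shows
    "(\<forall>A \<in> (moduli G :: ('v \<times> 'v \<Rightarrow> complex^'d^'d) set set). \<forall>m \<in> A. \<forall>L.
        set_mset L \<subseteq> geodesic_loops G \<longrightarrow>
        casimir_conn Or B (\<lambda>m'. tau (modulus G m') L) m =
          - ((of_nat (CARD('d)) - 1) * of_nat (S_occ G L) * tau A L
             + of_nat (Vplus Or L) * tau A L - of_nat (Vminus Or L) * tau A L
             + B_SM_plus G (tau A) L - B_SM_minus G (tau A) L)) \<and>
     (\<forall>A \<in> (moduli G :: ('v \<times> 'v \<Rightarrow> complex^'d^'d) set set). \<forall>m \<in> A. \<forall>L.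
        set_mset L \<subseteq> geodesic_loops G \<and> flow G L \<longrightarrow>
        casimir_conn Or B (\<lambda>m'. tau (modulus G m') L) m =
          - ((of_nat (CARD('d)) - 1) * of_nat (S_occ G L) * tau A L
             + of_nat (Vplus Or L) * tau A L
             + B_SM_plus G (tau A) L)) \<and>
     (\<forall>g \<in> (gauge_group G :: ('v \<Rightarrow> complex^'d^'d) set). \<forall>L.
        set_mset L \<subseteq> loops G \<longrightarrow>
        casimir_gauge G B (\<lambda>g'. T_gauge g' L) g =
          - ((of_nat (CARD('d)) - 1) * of_nat (S_occ G L) * T_gauge g L
             + of_nat (V_occ G L) * T_gauge g L
             + B_SM G (T_gauge g) L))"
proof (intro conjI ballI allI impI)
  fix A :: "('v \<times> 'v \<Rightarrow> complex^'d^'d) set" and m L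
  assume A: "A \<in> moduli G" "m \<in> A" and "set_mset L \<subseteq> geodesic_loops G"
  then have "set_mset L \<subseteq> loops G" using geodesic_loops_subset by blast
  then show "casimir_conn Or B (\<lambda>m'. tau (modulus G m') L) m =
          - ((of_nat (CARD('d)) - 1) * of_nat (S_occ G L) * tau A L
             + of_nat (Vplus Or L) * tau A L - of_nat (Vminus Or L) * tau A L
             + B_SM_plus G (tau A) L - B_SM_minus G (tau A) L)"
    by (rule casimir_conn_tau[OF assms(1,3,4) A])
next
  fix A :: "('v \<times> 'v \<Rightarrow> complex^'d^'d) set" and m L
  assume A: "A \<in> moduli G" "m \<in> A" and L: "set_mset L \<subseteq> geodesic_loops G \<and> flow G L"
  then have "set_mset L \<subseteq> loops G" using geodesic_loops_subset by blast
  then show "casimir_conn Or B (\<lambda>m'. tau (modulus G m') L) m =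
          - ((of_nat (CARD('d)) - 1) * of_nat (S_occ G L) * tau A L
             + of_nat (Vplus Or L) * tau A L + B_SM_plus G (tau A) L)"
    using casimir_conn_tau[OF assms(1,3,4) A] flow_no_opposite_crossings[OF assms(4)] L
    by simp
next
  fix g :: "'v \<Rightarrow> complex^'d^'d" and L
  assume "g \<in> gauge_group G" "set_mset L \<subseteq> loops G"
  moreover have "pair_fin_digraph G"
    using assms(1) by (simp add: pair_graph_def pair_digraph_def)
  ultimately show "casimir_gauge G B (\<lambda>g'. T_gauge g' L) g =
          - ((of_nat (CARD('d)) - 1) * of_nat (S_occ G L) * T_gauge g L
             + of_nat (V_occ G L) * T_gauge g L + B_SM G (T_gauge g) L)"
    by (intro casimir_gauge_T_gauge assms(3))
qed

end
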